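(* Let $(a,X)=(s,\vec q,X)$ be a pre-admissible parameter. Then the stabilizer $\mathrm{Stab}_{G(s)}X$ is connected, where $G(s)=Z_G(s)$.
   Context: $G=\mathrm{Sp}(2n,\mathbb C)$, $B\subset G$ a Borel subgroup, $T\subset B$ a maximal torus, $R^+$ the positive roots of $(G,T)$ determined by $B$. $V_1=\mathbb C^{2n}$ is the vector representation, $V_2=(\wedge^2V_1)/\mathbb C$, $\mathbb V=V_1\oplus V_2$; $\mathbb V^+$ is the sum of the $T$-weight spaces of $\mathbb V$ with weights in $\mathbb Q_{\ge0}R^+\setminus\{0\}$; $\mathfrak N_1=\bigcup_{g\in G}g\mathbb V^+\subset\mathbb V$ is the $1$-exotic nilpotent cone. An element $a=(s,q_0,q_1,q_2)\in G\times(\mathbb C^\times)^3$ (write $\vec q=(q_0,q_1,q_2)$) is pre-admissible if $s$ is semisimple, $q_0\ne q_1$, and $q_2$ is not a root of unity of order $\le 2n$. A pre-admissible parameter is a pair $(a,X)$ with $a$ pre-admissible and $X=X_1\oplus X_2\in\mathfrak N_1$ ($X_1\in V_1,X_2\in V_2$) such that $(s-q_0)(s-q_1)X_1=0$ and $sX_2=q_2X_2$. *)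

theory Defs
  imports "HOL-Analysis.Analysis" "HOL-Algebra.Solvable_Groups"
begin

section \<open>The Zariski topology on complex matrices\<close>

inductive poly_fun :: "(complex^'m^'m \<Rightarrow> complex) \<Rightarrow> bool" where
  const: "poly_fun (\<lambda>A. c)"
| entry: "poly_fun (\<lambda>A. A $ i $ j)"
| add: "poly_fun p \<Longrightarrow> poly_fun q \<Longrightarrow> poly_fun (\<lambda>A. p A + q A)"
| mult: "poly_fun p \<Longrightarrow> poly_fun q \<Longrightarrow> poly_fun (\<lambda>A. p A * q A)"

definition zariski_closed :: "(complex^'m^'m) set \<Rightarrow> bool" where
  "zariski_closed S \<longleftrightarrow> (\<exists>P. (\<forall>p\<in>P. poly_fun p) \<and> S = {A. \<forall>p\<in>P. p A = 0})"

definition zariski :: "(complex^'m^'m) topology" where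
  "zariski = topology (\<lambda>U. zariski_closed (- U))"

lemma zariski_closed_Un:
  assumes "zariski_closed S" "zariski_closed T"
  shows "zariski_closed (S \<union> T)"
proof -
  obtain P Q where P: "\<forall>p\<in>P. poly_fun p" "S = {A. \<forall>p\<in>P. p A = 0}"
    and Q: "\<forall>p\<in>Q. poly_fun p" "T = {A. \<forall>p\<in>Q. p A = 0}"
    using assms unfolding zariski_closed_def by auto
  let ?R = "{\<lambda>A. p A * q A |p q. p \<in> P \<and> q \<in> Q}"
  have "\<forall>r\<in>?R. poly_fun r"
    using P(1) Q(1) by (auto intro: poly_fun.mult)
  moreover have "S \<union> T = {A. \<forall>r\<in>?R. r A = 0}"
    unfolding P(2) Q(2) by fastforce
  ultimately show ?thesis unfolding zariski_closed_def by blast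
qed

lemma zariski_closed_Inter:
  assumes "\<And>S. S \<in> \<S> \<Longrightarrow> zariski_closed S"
  shows "zariski_closed (\<Inter>\<S>)"
proof -
  let ?P = "{p. poly_fun p \<and> (\<exists>S\<in>\<S>. \<forall>A\<in>S. p A = 0)}"
  have "A \<in> S" if A: "\<forall>p\<in>?P. p A = 0" and S: "S \<in> \<S>" for A S
  proof -
    obtain P where P: "\<forall>p\<in>P. poly_fun p" "S = {A. \<forall>p\<in>P. p A = 0}"
      using assms[OF S] unfolding zariski_closed_def by auto
    have "\<forall>p\<in>P. \<forall>A\<in>S. p A = 0" using P(2) by blast
    then have "P \<subseteq> ?P" using S P(1) by blast
    then show ?thesis using A P(2) by auto
  qed
  then have "\<Inter>\<S> = {A. \<forall>p\<in>?P. p A = 0}" by auto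
  then show ?thesis unfolding zariski_closed_def
    by (intro exI[of _ ?P]) simp
qed

lemma openin_zariski: "openin zariski U \<longleftrightarrow> zariski_closed (- U)"
  for U :: "(complex^'m^'m) set"
proof -
  have "istopology (\<lambda>U :: (complex^'m^'m) set. zariski_closed (- U))"
    unfolding istopology_def
  proof (intro conjI allI impI)
    fix S T :: "(complex^'m^'m) set"
    assume "zariski_closed (- S)" "zariski_closed (- T)"
    then show "zariski_closed (- (S \<inter> T))"
      by (simp add: zariski_closed_Un)
  next
    fix \<K> :: "(complex^'m^'m) set set"
    assume "\<forall>K\<in>\<K>. zariski_closed (- K)"
    then have "zariski_closed (\<Inter>(uminus ` \<K>))"
      by (intro zariski_closed_Inter) auto
    moreover have "- \<Union>\<K> = \<Inter>(uminus ` \<K>)" by auto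
    ultimately show "zariski_closed (- \<Union>\<K>)" by simp
  qed
  then show ?thesis unfolding zariski_def by simp
qed

lemma closedin_zariski: "closedin zariski S \<longleftrightarrow> zariski_closed S"
  for S :: "(complex^'m^'m) set"
proof -
  have "zariski_closed ({} :: (complex^'m^'m) set)"
    unfolding zariski_closed_def
    by (rule exI[of _ "{\<lambda>A. 1}"]) (auto intro: poly_fun.const)
  then have "openin zariski (UNIV :: (complex^'m^'m) set)"
    by (simp add: openin_zariski)
  then have "topspace (zariski :: (complex^'m^'m) topology) = UNIV"
    using openin_subset by blast
  then show ?thesis
    by (simp add: closedin_def openin_zariski Compl_eq_Diff_UNIV[symmetric])
qed


section \<open>The symplectic group\<close>

text \<open>The vector representation is \<^typ>\<open>complex^('n + 'n)\<close> with \<open>n = CARD('n)\<close>; the symplectic form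
  pairs the coordinate \<open>Inl i\<close> with \<open>Inr i\<close>.\<close>

type_synonym 'n cvec = "complex^('n + 'n)"
type_synonym 'n cmat = "complex^('n + 'n)^('n + 'n)"

definition Jmat :: "'n::finite cmat" where
  "Jmat = (\<chi> a b. case (a, b) of
      (Inl i, Inr j) \<Rightarrow> if i = j then 1 else 0
    | (Inr i, Inl j) \<Rightarrow> if i = j then - 1 else 0
    | _ \<Rightarrow> 0)"

definition Sp :: "'n::finite cmat set" where
  "Sp = {g. transpose g ** Jmat ** g = Jmat}"

definition Sp_group :: "'n::finite cmat monoid" where
  "Sp_group = \<lparr>carrier = Sp, mult = (**), one = mat 1\<rparr>"

lemma transpose_uminus: "transpose (- A) = - transpose (A :: 'a::ring_1^'m^'n)"
  by (simp add: transpose_def vec_eq_iff)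

lemma transpose_diff: "transpose (A - B) = transpose A - transpose (B :: 'a::ring_1^'m^'n)"
  by (simp add: transpose_def vec_eq_iff)

lemma transpose_add: "transpose (A + B) = transpose A + transpose (B :: 'a::ring_1^'m^'n)"
  by (simp add: transpose_def vec_eq_iff)

lemma mat_times_component: "(mat c ** A) $ i $ j = c * (A $ i $ j)"
  for A :: "'a::comm_ring_1^'m^'n"
  by (simp add: matrix_matrix_mult_def mat_def if_distrib[where f="\<lambda>x. x * _"] cong: if_cong)

lemma times_mat: "A ** mat c = mat c ** A" for A :: "'a::comm_ring_1^'n^'n"
  by (simp add: vec_eq_iff mat_times_component)
    (simp add: matrix_matrix_mult_def mat_def if_distrib[where f="\<lambda>x. _ * x"] mult.commute cong: if_cong)

lemma transpose_mat_times: "transpose (mat c ** A) = mat c ** transpose A"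
  for A :: "'a::comm_ring_1^'n^'n"
  by (simp add: vec_eq_iff mat_times_component transpose_def)

lemma mat_mult_uminus: "A ** (- B) = - (A ** B)" "(- A) ** B = - (A ** B)"
  for A :: "'a::comm_ring_1^'n^'m" and B :: "'a^'k^'n"
  by (simp_all add: vec_eq_iff matrix_matrix_mult_def sum_negf)

lemma transpose_Jmat: "transpose Jmat = - Jmat"
  by (auto simp: transpose_def Jmat_def vec_eq_iff split: sum.splits)

lemma Jmat_Jmat: "Jmat ** Jmat = - (mat 1 :: 'n::finite cmat)"
proof -
  have "(Jmat ** Jmat) $ a $ b = - (mat 1 :: 'n cmat) $ a $ b" for a b
  proof -
    have "(Jmat ** Jmat) $ a $ b = (\<Sum>c\<in>UNIV. Jmat $ a $ c * (Jmat :: 'n cmat) $ c $ b)"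
      by (simp add: matrix_matrix_mult_def)
    also have "\<dots> = (\<Sum>i\<in>UNIV. Jmat $ a $ Inl i * (Jmat :: 'n cmat) $ Inl i $ b)
        + (\<Sum>i\<in>UNIV. Jmat $ a $ Inr i * (Jmat :: 'n cmat) $ Inr i $ b)"
      by (simp add: UNIV_sum sum.union_disjoint Plus_def[symmetric] sum.Plus sum.reindex
          UNIV_Plus_UNIV[symmetric] del: UNIV_Plus_UNIV)
    also have "\<dots> = - (mat 1 :: 'n cmat) $ a $ b"
      by (cases a; cases b) (auto simp: Jmat_def mat_def if_distrib[where f="\<lambda>x. x * _"] sum_negf
          cong: if_cong)
    finally show ?thesis .
  qed
  then show ?thesis by (simp add: vec_eq_iff)
qed

lemma Sp_left_inverse: "g \<in> Sp \<Longrightarrow> (- (Jmat ** transpose g ** Jmat)) ** g = mat 1"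
proof -
  assume "g \<in> Sp"
  then have *: "transpose g ** Jmat ** g = Jmat" by (simp add: Sp_def)
  have "(- (Jmat ** transpose g ** Jmat)) ** g = - (Jmat ** (transpose g ** Jmat ** g))"
    by (simp add: mat_mult_uminus matrix_mul_assoc)
  then show ?thesis by (simp add: * Jmat_Jmat)
qed

lemma Sp_transpose: "g \<in> Sp \<Longrightarrow> g ** Jmat ** transpose g = Jmat"
proof -
  assume "g \<in> Sp"
  then have "g ** (- (Jmat ** transpose g ** Jmat)) = mat 1"
    using Sp_left_inverse matrix_left_right_inverse by blast
  then have "(- (g ** Jmat ** transpose g ** Jmat)) ** Jmat = mat 1 ** Jmat"
    by (simp add: mat_mult_uminus matrix_mul_assoc)
  then have "- (g ** Jmat ** transpose g ** (Jmat ** Jmat)) = Jmat"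
    by (simp add: mat_mult_uminus matrix_mul_assoc)
  then show ?thesis
    by (simp add: Jmat_Jmat mat_mult_uminus)
qed

lemma Sp_one: "mat 1 \<in> Sp"
  by (simp add: Sp_def transpose_mat)

lemma Sp_mult:
  assumes "g \<in> Sp" "h \<in> Sp"
  shows "g ** h \<in> Sp"
proof -
  have "transpose (g ** h) ** Jmat ** (g ** h) = transpose h ** (transpose g ** Jmat ** g) ** h"
    by (simp add: matrix_transpose_mul matrix_mul_assoc)
  then show ?thesis
    using assms by (simp add: Sp_def)
qed

lemma Sp_inverse:
  assumes "g \<in> Sp"
  shows "- (Jmat ** transpose g ** Jmat) \<in> Sp"
proof -
  have "- (Jmat ** transpose g ** Jmat) = h \<Longrightarrow> h \<in> Sp" for h
  proof -
    assume "- (Jmat ** transpose g ** Jmat) = h"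
    then have l: "h ** g = mat 1" using Sp_left_inverse[OF assms] by simp
    then have r: "g ** h = mat 1" by (simp add: matrix_left_right_inverse)
    then have rt: "transpose h ** transpose g = mat 1"
      by (metis matrix_transpose_mul transpose_mat)
    have "transpose h ** Jmat ** h = transpose h ** (transpose g ** Jmat ** g) ** h"
      using assms by (simp add: Sp_def)
    also have "\<dots> = (transpose h ** transpose g) ** Jmat ** (g ** h)"
      by (simp add: matrix_mul_assoc)
    finally show ?thesis by (simp add: r rt Sp_def)
  qed
  then show ?thesis by blast
qed

lemma group_Sp: "group Sp_group"
  unfolding Sp_group_def
  by (rule groupI)
    (auto simp: Sp_mult Sp_one matrix_mul_assoc intro: Sp_inverse Sp_left_inverse)


section \<open>The representation \<open>V\<^sub>2\<close>\<close>

text \<open>A bivector is encoded by its skew-symmetric coefficient matrix, \<open>u \<and> v\<close> being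
  \<open>u v\<^sup>T - v u\<^sup>T\<close>, so that \<open>g\<close> acts by \<open>A \<mapsto> g A g\<^sup>T\<close>. The invariant line is spanned by
  \<open>Jmat\<close>, the bivector \<open>\<Sum>\<^sub>i e\<^sub>i \<and> f\<^sub>i\<close> of a symplectic basis.\<close>

definition V2_rel :: "'n::finite cmat \<Rightarrow> 'n cmat \<Rightarrow> bool" where
  "V2_rel A B \<longleftrightarrow> transpose A = - A \<and> transpose B = - B \<and> (\<exists>c. A - B = mat c ** Jmat)"

lemma mat_times_add: "mat (a + b) ** A = mat a ** A + mat b ** A"
  for A :: "'a::comm_ring_1^'m^'n"
  by (simp add: vec_eq_iff mat_times_component distrib_right)

lemma mat_times_uminus: "mat (- a) ** A = - (mat a ** A)"
  for A :: "'a::comm_ring_1^'m^'n"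
  by (simp add: vec_eq_iff mat_times_component)

lemma mat_times_0: "mat 0 ** A = (0 :: 'a::comm_ring_1^'m^'n)"
  by (simp add: vec_eq_iff mat_times_component)

quotient_type (overloaded) 'n V2 = "'n::finite cmat" / partial: V2_rel
proof (rule part_equivpI)
  show "\<exists>A :: 'n cmat. V2_rel A A"
    by (rule exI[of _ 0]) (auto simp: V2_rel_def transpose_def vec_eq_iff mat_times_component
        intro!: exI[of _ 0])
  show "symp (V2_rel :: 'n cmat \<Rightarrow> _)"
    unfolding V2_rel_def by (intro sympI) (metis mat_times_uminus minus_diff_eq)
  show "transp (V2_rel :: 'n cmat \<Rightarrow> _)"
  proof (intro transpI)
    fix A B C :: "'n cmat"
    assume *: "V2_rel A B" "V2_rel B C"
    then obtain a b where "A - B = mat a ** Jmat" "B - C = mat b ** Jmat"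
      by (auto simp: V2_rel_def)
    moreover have "A - C = (A - B) + (B - C)" by simp
    ultimately have "A - C = mat (a + b) ** Jmat" by (simp only: mat_times_add)
    with * show "V2_rel A C" by (auto simp: V2_rel_def)
  qed
qed

lemma V2_rel_refl: "transpose A = - A \<Longrightarrow> V2_rel A A"
  by (auto simp: V2_rel_def mat_times_0 intro!: exI[of _ 0])

instantiation V2 :: (finite) ab_group_add
begin

lift_definition zero_V2 :: "'a V2" is 0
  by (simp add: V2_rel_refl transpose_def vec_eq_iff)

lift_definition plus_V2 :: "'a V2 \<Rightarrow> 'a V2 \<Rightarrow> 'a V2" is "(+)"
proof -
  fix A B C D :: "'a cmat"
  assume *: "V2_rel A B" "V2_rel C D"
  then obtain a b where "A - B = mat a ** Jmat" "C - D = mat b ** Jmat"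
    by (auto simp: V2_rel_def)
  moreover have "(A + C) - (B + D) = (A - B) + (C - D)" by simp
  ultimately have "(A + C) - (B + D) = mat (a + b) ** Jmat" by (simp only: mat_times_add)
  with * show "V2_rel (A + C) (B + D)" by (auto simp: V2_rel_def transpose_add)
qed

lift_definition uminus_V2 :: "'a V2 \<Rightarrow> 'a V2" is uminus
proof -
  fix A B :: "'a cmat"
  assume *: "V2_rel A B"
  then obtain a where "A - B = mat a ** Jmat" by (auto simp: V2_rel_def)
  moreover have "- A - - B = - (A - B)" by simp
  ultimately have "- A - - B = mat (- a) ** Jmat" by (simp only: mat_times_uminus)
  with * show "V2_rel (- A) (- B)" unfolding V2_rel_def transpose_uminus by auto
qed

definition minus_V2 :: "'a V2 \<Rightarrow> 'a V2 \<Rightarrow> 'a V2" where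
  "minus_V2 X Y = X + - Y"

instance
proof
  fix a b c :: "'a V2"
  show "a + b + c = a + (b + c)"
    by transfer (auto simp: V2_rel_def transpose_add add_ac mat_times_0 intro!: exI[of _ 0])
  show "a + b = b + a"
    by transfer (auto simp: V2_rel_def transpose_add add_ac mat_times_0 intro!: exI[of _ 0])
  show "0 + a = a"
    by transfer simp
  show "- a + a = 0"
    by transfer (simp add: V2_rel_refl transpose_def vec_eq_iff)
  show "a - b = a + - b"
    by (rule minus_V2_def)
qed

end

lift_definition V2_scale :: "complex \<Rightarrow> 'n::finite V2 \<Rightarrow> 'n V2" is "\<lambda>c A. mat c ** A"
proof -
  fix c and A B :: "'n cmat"
  assume *: "V2_rel A B"
  then obtain a where "A - B = mat a ** Jmat" by (auto simp: V2_rel_def)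
  then have "mat c ** A - mat c ** B = mat (c * a) ** Jmat"
    by (simp add: vec_eq_iff mat_times_component mult.assoc right_diff_distrib[symmetric])
  with * show "V2_rel (mat c ** A) (mat c ** B)"
    unfolding V2_rel_def transpose_mat_times by (auto simp: mat_mult_uminus)
qed

text \<open>Only elements of \<^const>\<open>Sp\<close> preserve the line spanned by \<^const>\<open>Jmat\<close>; the other branch is never used.\<close>

lift_definition V2_act :: "'n::finite cmat \<Rightarrow> 'n V2 \<Rightarrow> 'n V2" is
  "\<lambda>g A. if g \<in> Sp then g ** A ** transpose g else 0"
proof -
  fix g and A B :: "'n cmat"
  assume *: "V2_rel A B"
  then obtain a where a: "A - B = mat a ** Jmat" by (auto simp: V2_rel_def)
  have "V2_rel (g ** A ** transpose g) (g ** B ** transpose g)" if "g \<in> Sp"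
  proof -
    have "g ** A ** transpose g - g ** B ** transpose g = g ** (A - B) ** transpose g"
      by (simp add: vec_eq_iff matrix_matrix_mult_def sum_subtractf algebra_simps)
    also have "\<dots> = mat a ** (g ** Jmat ** transpose g)"
      unfolding a by (metis matrix_mul_assoc times_mat)
    also have "\<dots> = mat a ** Jmat" by (simp add: Sp_transpose that)
    finally have "\<exists>c. g ** A ** transpose g - g ** B ** transpose g = mat c ** Jmat" by blast
    with * show ?thesis
      unfolding V2_rel_def by (simp add: matrix_transpose_mul matrix_mul_assoc mat_mult_uminus)
  qed
  moreover have "V2_rel 0 (0 :: 'n cmat)"
    by (auto intro!: V2_rel_refl simp: transpose_def vec_eq_iff)
  ultimately show "V2_rel (if g \<in> Sp then g ** A ** transpose g else 0)
      (if g \<in> Sp then g ** B ** transpose g else 0)" by simp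
qed


section \<open>The representation \<open>V\<close>\<close>

type_synonym 'n V = "'n cvec \<times> 'n V2"

definition V_act :: "'n::finite cmat \<Rightarrow> 'n V \<Rightarrow> 'n V" where
  "V_act g X = (g *v fst X, V2_act g (snd X))"

definition V_scale :: "complex \<Rightarrow> 'n::finite V \<Rightarrow> 'n V" where
  "V_scale c X = (c *s fst X, V2_scale c (snd X))"


section \<open>Borel subgroups, maximal tori, roots\<close>

definition simult_diagonalizable :: "(complex^'m^'m) set \<Rightarrow> bool" where
  "simult_diagonalizable S \<longleftrightarrow>
    (\<exists>P :: complex^'m^'m. invertible P \<and> (\<forall>g\<in>S. \<forall>i j. i \<noteq> j \<longrightarrow> (P ** g ** matrix_inv P) $ i $ j = 0))"

definition semisimple :: "complex^'m^'m \<Rightarrow> bool" where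
  "semisimple s \<longleftrightarrow> simult_diagonalizable {s}"

definition closed_connected_subgroup :: "'n::finite cmat set \<Rightarrow> bool" where
  "closed_connected_subgroup H \<longleftrightarrow>
    subgroup H Sp_group \<and> closedin zariski H \<and> connectedin zariski H"

definition conn_solvable_subgroup :: "'n::finite cmat set \<Rightarrow> bool" where
  "conn_solvable_subgroup H \<longleftrightarrow>
    closed_connected_subgroup H \<and> solvable (Sp_group\<lparr>carrier := H\<rparr>)"

definition borel_subgroup :: "'n::finite cmat set \<Rightarrow> bool" where
  "borel_subgroup B \<longleftrightarrow> conn_solvable_subgroup B \<and>
    (\<forall>H. conn_solvable_subgroup H \<and> B \<subseteq> H \<longrightarrow> H = B)"

text \<open>A torus is a connected diagonalizable algebraic group.\<close>

definition torus :: "'n::finite cmat set \<Rightarrow> bool" where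
  "torus T \<longleftrightarrow> closed_connected_subgroup T \<and> simult_diagonalizable T"

definition maximal_torus :: "'n::finite cmat set \<Rightarrow> bool" where
  "maximal_torus T \<longleftrightarrow> torus T \<and> (\<forall>H. torus H \<and> T \<subseteq> H \<longrightarrow> H = T)"

text \<open>Characters are written multiplicatively. Elements of \<^const>\<open>Sp\<close> have determinant 1, so
  the regular functions on \<open>T\<close> are the restrictions of polynomials in the matrix entries.
  Extensionality makes equality of characters mean equality on \<open>T\<close>.\<close>

definition characters :: "'n::finite cmat set \<Rightarrow> ('n cmat \<Rightarrow> complex) set" where
  "characters T = {\<mu>. \<mu> \<in> extensional T \<and> (\<exists>p. poly_fun p \<and> (\<forall>t\<in>T. \<mu> t = p t)) \<and>
    (\<forall>t\<in>T. \<mu> t \<noteq> 0) \<and> (\<forall>t\<in>T. \<forall>u\<in>T. \<mu> (t ** u) = \<mu> t * \<mu> u)}"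

definition nontrivial_on :: "'n::finite cmat set \<Rightarrow> ('n cmat \<Rightarrow> complex) \<Rightarrow> bool" where
  "nontrivial_on T \<mu> \<longleftrightarrow> (\<exists>t\<in>T. \<mu> t \<noteq> 1)"

text \<open>The Lie algebra is the Zariski tangent space at the identity.\<close>

definition lie_algebra :: "'n::finite cmat set \<Rightarrow> 'n cmat set" where
  "lie_algebra H = {Y. \<forall>p. poly_fun p \<and> (\<forall>h\<in>H. p h = 0) \<longrightarrow>
    ((\<lambda>z. p (mat 1 + mat z ** Y)) has_field_derivative 0) (at 0)}"

text \<open>The positive roots determined by \<open>B\<close> are the nontrivial weights of \<open>T\<close> on the Lie algebra
  of \<open>B\<close> under the adjoint action.\<close>

definition positive_roots ::
    "'n::finite cmat set \<Rightarrow> 'n cmat set \<Rightarrow> ('n cmat \<Rightarrow> complex) set" where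
  "positive_roots B T = {\<alpha> \<in> characters T. nontrivial_on T \<alpha> \<and>
    (\<exists>Y \<in> lie_algebra B. Y \<noteq> 0 \<and> (\<forall>t\<in>T. t ** Y ** matrix_inv t = mat (\<alpha> t) ** Y))}"

text \<open>Membership of \<open>\<mu>\<close> in the cone \<open>\<rat>\<^sub>\<ge>\<^sub>0 R\<^sup>+\<close> of the rational character space, with denominators
  cleared: \<open>N \<mu> = \<Sum> c\<^sub>\<alpha> \<alpha>\<close> for some \<open>N > 0\<close> and natural numbers \<open>c\<^sub>\<alpha>\<close>. The character group of a
  torus is torsion free, so \<open>\<mu>\<close> is zero there iff it is trivial on \<open>T\<close>.\<close>

definition in_rational_cone ::
    "'n::finite cmat set \<Rightarrow> ('n cmat \<Rightarrow> complex) set \<Rightarrow> ('n cmat \<Rightarrow> complex) \<Rightarrow> bool" where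
  "in_rational_cone T R \<mu> \<longleftrightarrow>
    (\<exists>N F. \<exists>c :: ('n cmat \<Rightarrow> complex) \<Rightarrow> nat. 0 < (N::nat) \<and> finite F \<and> F \<subseteq> R \<and>
      (\<forall>t\<in>T. \<mu> t ^ N = (\<Prod>\<alpha>\<in>F. \<alpha> t ^ c \<alpha>)))"


section \<open>The exotic nilpotent cone\<close>

definition weight_space ::
    "'n::finite cmat set \<Rightarrow> ('n cmat \<Rightarrow> complex) \<Rightarrow> 'n V set" where
  "weight_space T \<mu> = {X. \<forall>t\<in>T. V_act t X = V_scale (\<mu> t) X}"

definition V_plus :: "'n::finite cmat set \<Rightarrow> 'n cmat set \<Rightarrow> 'n V set" where
  "V_plus B T = {(\<Sum>\<mu>\<in>M. f \<mu>) | M f. finite M \<and> M \<subseteq> characters T \<and>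
    (\<forall>\<mu>\<in>M. nontrivial_on T \<mu> \<and> in_rational_cone T (positive_roots B T) \<mu> \<and>
      f \<mu> \<in> weight_space T \<mu>)}"

definition exotic_nilcone :: "'n::finite cmat set \<Rightarrow> 'n cmat set \<Rightarrow> 'n V set" where
  "exotic_nilcone B T = (\<Union>g\<in>Sp. V_act g ` V_plus B T)"


section \<open>Pre-admissible parameters\<close>

definition pre_admissible ::
    "'n::finite cmat \<Rightarrow> complex \<times> complex \<times> complex \<Rightarrow> bool" where
  "pre_admissible s = (\<lambda>(q\<^sub>0, q\<^sub>1, q\<^sub>2).
    s \<in> Sp \<and> q\<^sub>0 \<noteq> 0 \<and> q\<^sub>1 \<noteq> 0 \<and> q\<^sub>2 \<noteq> 0 \<and> semisimple s \<and> q\<^sub>0 \<noteq> q\<^sub>1 \<and>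
    (\<forall>k. 1 \<le> k \<and> k \<le> 2 * CARD('n) \<longrightarrow> q\<^sub>2 ^ k \<noteq> 1))"

definition pre_admissible_parameter ::
    "'n::finite cmat set \<Rightarrow> 'n cmat set \<Rightarrow> 'n cmat \<Rightarrow> complex \<times> complex \<times> complex \<Rightarrow> 'n V \<Rightarrow> bool" where
  "pre_admissible_parameter B T s = (\<lambda>(q\<^sub>0, q\<^sub>1, q\<^sub>2) X.
    pre_admissible s (q\<^sub>0, q\<^sub>1, q\<^sub>2) \<and> X \<in> exotic_nilcone B T \<and>
    ((s - mat q\<^sub>0) ** (s - mat q\<^sub>1)) *v fst X = 0 \<and>
    V2_act s (snd X) = V2_scale q\<^sub>2 (snd X))"

definition Sp_centralizer :: "'n::finite cmat \<Rightarrow> 'n cmat set" where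
  "Sp_centralizer s = {g \<in> Sp. g ** s = s ** g}"

definition stabilizer :: "'n::finite cmat set \<Rightarrow> 'n V \<Rightarrow> 'n cmat set" where
  "stabilizer H X = {g \<in> H. V_act g X = X}"

end

theory Submission
  imports Defs "HOL-Computational_Algebra.Polynomial"
begin

text \<open>The bivector component of a parameter is represented by a self-adjoint operator \<open>x\<close> with
  \<open>s x s\<^sup>-\<^sup>1 = q x\<close>, and the stabilizer becomes the group \<open>H\<close> of symplectic operators that commute
  with \<open>s\<close> and \<open>x\<close> and fix a vector \<open>v\<close>. The proof joins every \<open>g\<close> in \<open>H\<close> to \<open>1\<close> by curves inside
  \<open>H\<close>. This gives connectedness in the Euclidean topology, hence in the coarser Zariski
  topology.

  If \<open>-1\<close> is not an eigenvalue of \<open>g\<close>, then the Moebius transforms \<open>(g + t) (1 + t g)\<^sup>-\<^sup>1\<close>,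
  with \<open>t\<close> outside a finite set, form such a curve (\<open>connected_component_one_if_invertible\<close>). In
  general let \<open>e\<close> be the projection onto the generalized eigenspace for \<open>-1\<close>
  (\<open>spectral_idempotent\<close>). It is self-adjoint, commutes with \<open>s\<close> and \<open>x\<close>, and kills \<open>v\<close>, since \<open>g\<close>
  fixes \<open>v\<close>. So \<open>1 - 2 e\<close> lies in \<open>H\<close>, and \<open>g (1 - 2 e)\<close> does not have the
  eigenvalue \<open>-1\<close>. It remains to join \<open>1 - 2 e\<close> to \<open>1\<close>, a problem on the image of \<open>e\<close>
  in which \<open>v\<close> no longer occurs.

  For this it suffices to find a square root of \<open>-1\<close> on the image of \<open>e\<close> that is symplectic and
  commutes with \<open>s\<close> and \<open>x\<close> (\<open>imaginary_unit_exists\<close>): extended by \<open>1\<close> it gives an element of \<open>H\<close>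
  with square \<open>1 - 2 e\<close> and without eigenvalue \<open>-1\<close>. Such a square root is the same as a
  decomposition into two Lagrangian subspaces stable under \<open>s\<close> and \<open>x\<close>. This is where the hypothesis
  on \<open>q\<close> enters: it makes \<open>x\<close> nilpotent (\<open>x_nilpotent\<close>), and for the nilpotency index \<open>k\<close> there are
  \<open>s\<close>-eigenvectors \<open>u\<close> and \<open>w\<close> such that \<open>x\<^sup>k\<^sup>-\<^sup>1 w\<close> pairs with \<open>u\<close> to \<open>1\<close>. As \<open>x\<close> is self-adjoint,
  each of \<open>u\<close> and \<open>w\<close> generates an isotropic \<open>x\<close>-module, and comparing \<open>s\<close>-weights shows that the
  pairing of \<open>x\<^sup>m w\<close> with \<open>u\<close> vanishes for all other \<open>m\<close>, so that the two modules are in duality. Their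
  sum is an orthogonal summand with the required decomposition (\<open>isotropic_projection_exists\<close>), and
  induction treats its complement.\<close>


section \<open>Matrix algebra\<close>

lemma matrix_add_rdistrib: "(A + B) ** C = A ** C + B ** C"
  for A B :: "'a::semiring_1^'k^'l"
  by (simp add: vec_eq_iff matrix_matrix_mult_def distrib_right sum.distrib)

lemma matrix_diff_ldistrib: "A ** (B - C) = A ** B - A ** C"
  for A :: "'a::ring_1^'k^'l"
  by (simp add: vec_eq_iff matrix_matrix_mult_def right_diff_distrib sum_subtractf)

lemma matrix_diff_rdistrib: "(A - B) ** C = A ** C - B ** C"
  for A B :: "'a::ring_1^'k^'l"
  by (simp add: vec_eq_iff matrix_matrix_mult_def left_diff_distrib sum_subtractf)

lemmas matrix_distribs =
  matrix_add_ldistrib matrix_add_rdistrib matrix_diff_ldistrib matrix_diff_rdistrib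

lemma matrix_sum_ldistrib: "A ** sum f I = (\<Sum>i\<in>I. A ** f i)"
  for A :: "'a::semiring_1^'k^'l"
  by (induction I rule: infinite_finite_induct) (simp_all add: matrix_add_ldistrib)

lemma matrix_sum_rdistrib: "sum f I ** A = (\<Sum>i\<in>I. f i ** A)"
  for A :: "'a::semiring_1^'k^'l"
  by (induction I rule: infinite_finite_induct) (simp_all add: matrix_add_rdistrib)

lemma matrix_vector_sum_rdistrib: "sum f I *v z = (\<Sum>i\<in>I. f i *v z)"
  for z :: "'a::semiring_1^'k"
  by (induction I rule: infinite_finite_induct) (simp_all add: matrix_vector_mult_add_rdistrib)

lemma matrix_vector_mult_scale: "A *v (c *s z) = c *s (A *v z)"
  for A :: "'a::comm_semiring_1^'k^'l"
  by (simp add: vec_eq_iff matrix_vector_mult_def sum_distrib_left mult.left_commute)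

lemma mat_vector_mult: "mat c *v z = c *s z" for z :: "'a::semiring_1^'k"
  by (simp add: vec_eq_iff matrix_vector_mult_def mat_def if_distrib[where f="\<lambda>x. x * _"]
      cong: if_cong)

lemma mat_times_mat: "mat c ** (mat d ** A) = mat (c * d) ** A"
  for A :: "'a::comm_ring_1^'k^'l"
  by (simp add: vec_eq_iff mat_times_component mult.assoc)

lemma mult_mat_times: "A ** (mat c ** B) = mat c ** (A ** B)"
  for A :: "'a::comm_ring_1^'l^'l"
  by (metis matrix_mul_assoc times_mat)

lemma matrix_inv_works:
  fixes A :: "'a::semiring_1^'k^'l"
  assumes "invertible A"
  shows "A ** matrix_inv A = mat 1" "matrix_inv A ** A = mat 1"
  using someI_ex[OF assms[unfolded invertible_def]] unfolding matrix_inv_def by auto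

lemma matrix_inv_commute:
  fixes A B :: "'a::semiring_1^'k^'k"
  assumes "invertible A" "A ** B = B ** A"
  shows "matrix_inv A ** B = B ** matrix_inv A"
proof -
  have "matrix_inv A ** B = matrix_inv A ** (B ** A) ** matrix_inv A"
    by (simp add: matrix_mul_assoc[symmetric] matrix_inv_works(1)[OF assms(1)])
  also have "\<dots> = (matrix_inv A ** A) ** B ** matrix_inv A"
    by (simp add: matrix_mul_assoc assms(2)[symmetric])
  finally show ?thesis by (simp add: matrix_inv_works(2)[OF assms(1)])
qed

lemma commute_left:
  fixes A B C :: "'a::semiring_1^'k^'k"
  assumes "A ** B = B ** A"
  shows "C ** A ** B = C ** B ** A"
  by (simp add: matrix_mul_assoc[symmetric] assms)

primrec mpow :: "'a::semiring_1^'k^'k \<Rightarrow> nat \<Rightarrow> 'a^'k^'k" where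
  "mpow A 0 = mat 1"
| "mpow A (Suc k) = A ** mpow A k"

lemma mpow_add: "mpow A (i + j) = mpow A i ** mpow A j"
  by (induction i) (simp_all add: matrix_mul_assoc)

lemma mpow_commute:
  assumes "A ** B = B ** A"
  shows "mpow A k ** B = B ** mpow A k"
proof (induction k)
  case (Suc k)
  have "mpow A (Suc k) ** B = A ** (mpow A k ** B)" by (simp add: matrix_mul_assoc)
  also have "\<dots> = (A ** B) ** mpow A k" by (simp add: Suc matrix_mul_assoc)
  finally show ?case by (simp add: assms matrix_mul_assoc)
qed simp

lemma mpow_Suc_right: "mpow A (Suc k) = mpow A k ** A"
  by (simp add: mpow_commute)

lemma mpow_eigenvector:
  fixes A :: "'a::comm_ring_1^'k^'k"
  assumes "A *v z = c *s z"
  shows "mpow A k *v z = c ^ k *s z"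
  by (induction k)
    (simp_all add: matrix_vector_mul_assoc[symmetric] assms matrix_vector_mult_scale mult.commute)


section \<open>The Fitting idempotent of a matrix\<close>

text \<open>The powers of \<open>A\<close> are linearly dependent. The lowest power that occurs in a dependence is
  a multiple of the next one, with a factor that is again a combination of powers.\<close>

lemma mpow_dependence:
  fixes A :: "complex^'k^'k"
  obtains r S where "mpow A (Suc r) = mpow A (Suc (Suc r)) ** S"
    "\<forall>B. A ** B = B ** A \<longrightarrow> S ** B = B ** S"
proof -
  have "\<exists>r S. mpow A r = mpow A (Suc r) ** S \<and> (\<forall>B. A ** B = B ** A \<longrightarrow> S ** B = B ** S)"
  proof (cases "inj (mpow A)")
    case False
    then obtain i j where ij: "mpow A i = mpow A j" "i < j"
      by (metis injI linorder_neqE_nat)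
    then have "mpow A i = mpow A (Suc i) ** mpow A (j - Suc i)"
      by (metis Suc_leI le_add_diff_inverse mpow_add)
    then show ?thesis using mpow_commute by blast
  next
    case True
    then have "infinite (range (mpow A))" using finite_imageD by blast
    then have "dependent (range (mpow A))" using independent_bound by blast
    then obtain t u where t: "finite t" "t \<subseteq> range (mpow A)" "(\<Sum>M\<in>t. u M *\<^sub>R M) = 0"
      and "\<exists>M\<in>t. u M \<noteq> 0"
      unfolding dependent_explicit by blast
    define c where "c i = u (mpow A i)" for i
    define I where "I = mpow A -` t"
    have finI: "finite I" unfolding I_def using t(1) True by (rule finite_vimageI)
    have im: "mpow A ` I = t" unfolding I_def using t(2) by auto
    have sum0: "(\<Sum>i\<in>I. c i *\<^sub>R mpow A i) = 0"
      using t(3) unfolding im[symmetric] c_def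
      by (subst (asm) sum.reindex) (use True in \<open>auto intro: inj_on_subset\<close>)
    define K where "K = {i \<in> I. c i \<noteq> 0}"
    have K: "finite K" "K \<noteq> {}"
      using finI \<open>\<exists>M\<in>t. u M \<noteq> 0\<close> im unfolding K_def c_def by auto
    define r where "r = Min K"
    have r: "r \<in> K" "\<And>i. i \<in> K \<Longrightarrow> r \<le> i" using K unfolding r_def by auto
    define S where "S = (\<Sum>i\<in>K - {r}. (- c i / c r) *\<^sub>R mpow A (i - Suc r))"
    have "(\<Sum>i\<in>K. c i *\<^sub>R mpow A i) = (\<Sum>i\<in>I. c i *\<^sub>R mpow A i)"
      by (rule sum.mono_neutral_left) (use finI in \<open>auto simp: K_def\<close>)
    then have "c r *\<^sub>R mpow A r + (\<Sum>i\<in>K - {r}. c i *\<^sub>R mpow A i) = 0"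
      using sum0 sum.remove[OF K(1) r(1)] by metis
    then have *: "c r *\<^sub>R mpow A r = - (\<Sum>i\<in>K - {r}. c i *\<^sub>R mpow A i)"
      by (simp add: eq_neg_iff_add_eq_0)
    have cr: "c r \<noteq> 0" using r(1) K_def by simp
    have "mpow A r = (1 / c r) *\<^sub>R (c r *\<^sub>R mpow A r)" using cr by simp
    also have "\<dots> = (\<Sum>i\<in>K - {r}. (- c i / c r) *\<^sub>R mpow A i)"
      unfolding * by (simp add: scaleR_sum_right sum_negf)
    also have "\<dots> = (\<Sum>i\<in>K - {r}. mpow A (Suc r) ** ((- c i / c r) *\<^sub>R mpow A (i - Suc r)))"
    proof (rule sum.cong[OF refl])
      fix i assume "i \<in> K - {r}"
      then have "Suc r \<le> i" using r(2)[of i] by auto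
      then have "mpow A i = mpow A (Suc r) ** mpow A (i - Suc r)"
        by (metis le_add_diff_inverse mpow_add)
      then show "(- c i / c r) *\<^sub>R mpow A i
          = mpow A (Suc r) ** ((- c i / c r) *\<^sub>R mpow A (i - Suc r))"
        by (simp only: matrix_scalar_ac scalar_matrix_assoc)
    qed
    also have "\<dots> = mpow A (Suc r) ** S" unfolding S_def by (simp only: matrix_sum_ldistrib)
    finally have "mpow A r = mpow A (Suc r) ** S" .
    moreover have "S ** B = B ** S" if "A ** B = B ** A" for B
      unfolding S_def matrix_sum_ldistrib matrix_sum_rdistrib
      by (rule sum.cong[OF refl])
        (simp only: matrix_scalar_ac scalar_matrix_assoc[symmetric] mpow_commute[OF that])
    ultimately show ?thesis by blast
  qed
  then obtain r S where rS: "mpow A r = mpow A (Suc r) ** S"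
    "\<forall>B. A ** B = B ** A \<longrightarrow> S ** B = B ** S" by blast
  have "mpow A (Suc r) = mpow A (Suc (Suc r)) ** S"
    using arg_cong[OF rS(1), of "(**) A"] unfolding mpow.simps matrix_mul_assoc .
  with that rS(2) show ?thesis by blast
qed

text \<open>Iterating the relation of the previous lemma gives \<open>U = U\<^sup>2 S\<close> for a power \<open>U\<close> of \<open>A\<close>; then
  \<open>U S\<close> is idempotent, and its complement \<open>e\<close> projects onto the generalized kernel of \<open>A\<close>. The
  exponent is positive, so that \<open>U\<close> vanishes on the kernel of \<open>A\<close>.\<close>

lemma fitting_idempotent:
  fixes A :: "complex^'k^'k"
  obtains e r S where "e ** e = e" "mpow A (Suc r) ** e = 0"
    "mat 1 - e = S ** mpow A (Suc r)"
    "\<forall>B. A ** B = B ** A \<longrightarrow> e ** B = B ** e"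
    "\<forall>B. A ** B = B ** A \<longrightarrow> S ** B = B ** S"
proof -
  obtain r S where S: "mpow A (Suc r) = mpow A (Suc (Suc r)) ** S"
    "\<forall>B. A ** B = B ** A \<longrightarrow> S ** B = B ** S" by (rule mpow_dependence)
  define U where "U = mpow A (Suc r)"
  have "\<exists>S'. U = U ** mpow A m ** S' \<and> (\<forall>B. A ** B = B ** A \<longrightarrow> S' ** B = B ** S')" for m
  proof (induction m)
    case 0
    show ?case by (rule exI[of _ "mat 1"]) simp
  next
    case (Suc m)
    then obtain S' where S': "U = U ** mpow A m ** S'" "\<And>B. A ** B = B ** A \<Longrightarrow> S' ** B = B ** S'"
      by blast
    have US: "U ** A ** S = U"
      unfolding U_def mpow_Suc_right[symmetric] by (rule S(1)[symmetric])
    have SA: "S ** mpow A m = mpow A m ** S"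
      by (rule mpow_commute[symmetric]) (use S(2) in auto)
    have "U = U ** A ** S ** mpow A m ** S'" unfolding US by (rule S'(1))
    also have "\<dots> = U ** A ** (S ** mpow A m) ** S'" by (simp add: matrix_mul_assoc)
    also have "\<dots> = U ** mpow A (Suc m) ** (S ** S')"
      unfolding SA by (simp add: matrix_mul_assoc)
    finally have "U = U ** mpow A (Suc m) ** (S ** S')" .
    moreover have "(S ** S') ** B = B ** (S ** S')" if "A ** B = B ** A" for B
    proof -
      have "S ** S' ** B = S ** (S' ** B)" by (simp add: matrix_mul_assoc)
      also have "\<dots> = (S ** B) ** S'" by (simp add: S'(2)[OF that] matrix_mul_assoc)
      finally show ?thesis using S(2) that by (simp add: matrix_mul_assoc)
    qed
    ultimately show ?case by blast
  qed
  from this[of "Suc r"] obtain S' where S': "U = U ** U ** S'"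
    "\<And>B. A ** B = B ** A \<Longrightarrow> S' ** B = B ** S'" unfolding U_def by blast
  have U: "U ** B = B ** U" if "A ** B = B ** A" for B
    unfolding U_def by (rule mpow_commute[OF that])
  have S'U: "S' ** U = U ** S'" by (rule S'(2)) (use U[of A] in simp)
  define f where "f = U ** S'"
  have Uf: "U ** f = U" using S'(1) unfolding f_def by (simp add: matrix_mul_assoc)
  have ff: "f ** f = f" 
  proof -
    have "f ** f = U ** (S' ** U) ** S'" by (simp add: f_def matrix_mul_assoc)
    also have "\<dots> = (U ** f) ** S'" unfolding S'U by (simp add: f_def matrix_mul_assoc)
    finally have "f ** f = (U ** f) ** S'" .
    then show ?thesis by (simp only: Uf f_def[symmetric])
  qed
  have fB: "f ** B = B ** f" if "A ** B = B ** A" for B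
  proof -
    have "f ** B = U ** (S' ** B)" by (simp add: f_def matrix_mul_assoc)
    also have "\<dots> = (U ** B) ** S'" by (simp add: S'(2)[OF that] matrix_mul_assoc)
    finally show ?thesis by (simp add: U[OF that] f_def matrix_mul_assoc)
  qed
  show ?thesis
  proof
    show "(mat 1 - f) ** (mat 1 - f) = mat 1 - f" by (simp add: matrix_distribs ff)
    show "mpow A (Suc r) ** (mat 1 - f) = 0"
      unfolding U_def[symmetric] by (simp add: matrix_distribs Uf)
    show "mat 1 - (mat 1 - f) = S' ** mpow A (Suc r)"
      unfolding U_def[symmetric] by (simp add: f_def S'U)
    show "\<forall>B. A ** B = B ** A \<longrightarrow> (mat 1 - f) ** B = B ** (mat 1 - f)"
      by (simp add: matrix_distribs fB)
    show "\<forall>B. A ** B = B ** A \<longrightarrow> S' ** B = B ** S'" using S'(2) by blast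
  qed
qed


section \<open>Matrix inversion along a path\<close>

lemma continuous_on_det:
  fixes f :: "'t::topological_space \<Rightarrow> complex^'k^'k"
  assumes "continuous_on I f"
  shows "continuous_on I (\<lambda>t. det (f t))"
  unfolding det_def using assms by (intro continuous_intros) auto

lemma continuous_on_matrix_mult:
  fixes f g :: "'t::topological_space \<Rightarrow> complex^'k^'k"
  assumes "continuous_on I f" "continuous_on I g"
  shows "continuous_on I (\<lambda>t. f t ** g t)"
  unfolding matrix_matrix_mult_def using assms by (intro continuous_intros) auto

text \<open>Cramer's rule expresses the entries of the inverse as quotients of determinants.\<close>

lemma continuous_on_matrix_inv:
  fixes f :: "'t::topological_space \<Rightarrow> complex^'k^'k"
  assumes "continuous_on I f" "\<And>t. t \<in> I \<Longrightarrow> invertible (f t)"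
  shows "continuous_on I (\<lambda>t. matrix_inv (f t))"
proof -
  let ?M = "\<lambda>t i k. \<chi> a b. if b = i then (axis k 1 :: complex^'k) $ a else f t $ a $ b"
  have "matrix_inv (f t) = (\<chi> i k. det (?M t i k) / det (f t))" if "t \<in> I" for t
  proof -
    have "matrix_inv (f t) $ i $ k = det (?M t i k) / det (f t)" for i k
    proof -
      have "f t *v (matrix_inv (f t) *v axis k 1) = axis k 1"
        using assms(2)[OF that] by (simp add: matrix_vector_mul_assoc matrix_inv_works)
      then have "matrix_inv (f t) *v axis k 1 = (\<chi> i. det (?M t i k) / det (f t))"
        using assms(2)[OF that] by (simp add: cramer invertible_det_nz)
      then have "(matrix_inv (f t) *v axis k 1) $ i = det (?M t i k) / det (f t)" by simp
      then show ?thesis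
        by (simp add: matrix_vector_mult_def axis_def if_distrib[where f="\<lambda>x. _ * x"] cong: if_cong)
    qed
    then show ?thesis by (simp add: vec_eq_iff)
  qed
  moreover have "continuous_on I (\<lambda>t. \<chi> i k. det (?M t i k) / det (f t))"
  proof (intro continuous_intros continuous_on_det assms(1))
    fix i k a b :: 'k
    show "continuous_on I (\<lambda>t. if b = i then axis k 1 $ a else f t $ a $ b)"
      using assms(1) by (cases "b = i") (auto intro!: continuous_intros)
  qed (use assms(2) invertible_det_nz in blast)+
  ultimately show ?thesis by (simp cong: continuous_on_cong)
qed

text \<open>The values \<open>t\<close> to be avoided are the roots of the polynomial \<open>det (1 + t A)\<close>, which is
  nonzero at \<open>t = 0\<close>.\<close>

lemma finite_singular_values:
  fixes A :: "complex^'k^'k"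
  shows "finite {t. \<not> invertible (mat 1 + mat t ** A)}"
proof -
  define p where "p = (\<Sum>\<pi> | \<pi> permutes (UNIV :: 'k set). of_int (sign \<pi>) *
    (\<Prod>i\<in>UNIV. [:(mat 1 :: complex^'k^'k) $ i $ \<pi> i, A $ i $ \<pi> i:]))"
  have p: "det (mat 1 + mat t ** A) = poly p t" for t
    unfolding det_def p_def poly_sum poly_mult poly_prod
    by (simp add: mat_times_component)
  have "poly p 0 \<noteq> 0" using p[of 0] by (simp del: mat_0 add: mat_times_0)
  then have "p \<noteq> 0" by auto
  then show ?thesis by (simp add: invertible_det_nz p poly_roots_finite)
qed


section \<open>The adjoint with respect to the symplectic form\<close>

definition symp :: "'n::finite cvec \<Rightarrow> 'n cvec \<Rightarrow> complex" where
  "symp u w = (\<Sum>a\<in>UNIV. u $ a * (Jmat *v w) $ a)"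

text \<open>Since \<open>Jmat\<^sup>-\<^sup>1 = - Jmat\<close>, this is the adjoint for the form \<^const>\<open>symp\<close>.\<close>

definition adj :: "'n::finite cmat \<Rightarrow> 'n cmat" where
  "adj A = - (Jmat ** transpose A ** Jmat)"

text \<open>The rank one operator \<open>z \<mapsto> symp z w u\<close>.\<close>

definition rank_one :: "'n::finite cvec \<Rightarrow> 'n cvec \<Rightarrow> 'n cmat" where
  "rank_one u w = (\<chi> a b. u $ a * (Jmat *v w) $ b)"

lemma uminus_matrix_vector_mult: "(- A) *v z = - (A *v z)"
  for A :: "'a::ring_1^'k^'l"
  by (simp add: vec_eq_iff matrix_vector_mult_def sum_negf)

lemma matrix_vector_mult_uminus: "A *v (- z) = - (A *v z)"
  for A :: "'a::ring_1^'k^'l"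
  by (simp add: vec_eq_iff matrix_vector_mult_def sum_negf)

lemma sum_mult_matrix_vector:
  "(\<Sum>a\<in>UNIV. u $ a * (A *v w) $ a) = (\<Sum>a\<in>UNIV. (transpose A *v u) $ a * w $ a)"
  for A :: "complex^'k^'l"
  unfolding matrix_vector_mult_def transpose_def
  by (simp add: sum_distrib_left sum_distrib_right, subst sum.swap) (simp add: mult_ac)

lemma Jmat_vector_Jmat_vector: "Jmat *v (Jmat *v w) = - w"
  by (simp add: matrix_vector_mul_assoc Jmat_Jmat uminus_matrix_vector_mult)

lemma symp_skew: "symp u w = - symp w u"
  unfolding symp_def
  by (subst sum_mult_matrix_vector)
    (simp add: transpose_Jmat uminus_matrix_vector_mult sum_negf mult.commute)

lemma symp_scale_left: "symp (c *s u) w = c * symp u w"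
  by (simp add: symp_def sum_distrib_left mult.assoc)

lemma symp_scale_right: "symp u (c *s w) = c * symp u w"
  by (simp add: symp_def sum_distrib_left matrix_vector_mult_scale mult.left_commute)

lemma symp_0_right: "symp u 0 = 0"
  by (simp add: symp_def)

lemma adj_adj: "adj (adj A) = A"
proof -
  have "adj (adj A) = (Jmat ** Jmat) ** A ** (Jmat ** Jmat)"
    unfolding adj_def transpose_uminus matrix_transpose_mul
    by (simp add: transpose_Jmat mat_mult_uminus matrix_mul_assoc)
  then show ?thesis by (simp add: Jmat_Jmat mat_mult_uminus)
qed

lemma adj_mult: "adj (A ** B) = adj B ** adj A"
proof -
  have "adj B ** adj A = Jmat ** transpose B ** (Jmat ** Jmat) ** transpose A ** Jmat"
    by (simp add: adj_def mat_mult_uminus matrix_mul_assoc)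
  then show ?thesis
    by (simp add: Jmat_Jmat adj_def mat_mult_uminus matrix_transpose_mul matrix_mul_assoc)
qed

lemma adj_add: "adj (A + B) = adj A + adj B"
  by (simp add: adj_def transpose_add matrix_distribs)

lemma adj_diff: "adj (A - B) = adj A - adj B"
  by (simp add: adj_def transpose_diff matrix_distribs)

lemma adj_0: "adj 0 = 0"
  using adj_diff[of 0 0] by simp

lemma adj_1: "adj (mat 1) = mat 1"
  by (simp add: adj_def Jmat_Jmat transpose_mat)

lemma adj_scale: "adj (mat c ** A) = mat c ** adj A"
  by (simp add: adj_def transpose_mat_times mult_mat_times matrix_mul_assoc[symmetric]
      mat_mult_uminus)

lemma adj_mat: "adj (mat c) = mat c"
  using adj_scale[of c "mat 1"] by (simp add: adj_1)

lemma adj_sum: "adj (sum f I) = (\<Sum>i\<in>I. adj (f i))"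
  by (induction I rule: infinite_finite_induct) (simp_all add: adj_0 adj_add)

lemma adj_mpow: "adj (mpow A k) = mpow (adj A) k"
  by (induction k) (simp_all add: adj_1 adj_mult mpow_commute)

lemma Sp_iff_adj: "g \<in> Sp \<longleftrightarrow> adj g ** g = mat 1"
proof
  assume "adj g ** g = mat 1"
  then have "Jmat ** (adj g ** g) = Jmat" by simp
  then have "- ((Jmat ** Jmat) ** transpose g ** Jmat ** g) = Jmat"
    by (simp add: adj_def mat_mult_uminus matrix_mul_assoc)
  then show "g \<in> Sp" by (simp add: Sp_def Jmat_Jmat mat_mult_uminus)
qed (simp add: adj_def Sp_left_inverse)

lemma symp_adj: "symp (A *v u) w = symp u (adj A *v w)"
proof -
  have "symp (A *v u) w = (\<Sum>a\<in>UNIV. u $ a * (transpose A *v (Jmat *v w)) $ a)"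
    unfolding symp_def using sum_mult_matrix_vector[of u "transpose A" "Jmat *v w"]
    by simp
  also have "transpose A *v (Jmat *v w) = Jmat *v (adj A *v w)"
    by (simp add: adj_def uminus_matrix_vector_mult matrix_vector_mult_uminus
        matrix_vector_mul_assoc[symmetric] Jmat_vector_Jmat_vector)
  finally show ?thesis by (simp add: symp_def)
qed

lemma rank_one_vector: "rank_one u w *v z = symp z w *s u"
  by (simp add: rank_one_def symp_def vec_eq_iff matrix_vector_mult_def sum_distrib_left
      sum_distrib_right mult_ac)

lemma rank_one_scale: "rank_one (c *s u) w = mat c ** rank_one u w"
  "rank_one u (c *s w) = mat c ** rank_one u w"
  by (simp_all add: rank_one_def vec_eq_iff mat_times_component matrix_vector_mult_scale)

lemma rank_one_0: "rank_one 0 w = 0" "rank_one u 0 = 0"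
  by (simp_all add: rank_one_def vec_eq_iff)

lemma mult_rank_one: "A ** rank_one u w = rank_one (A *v u) w"
  by (simp add: matrix_eq matrix_vector_mul_assoc[symmetric] rank_one_vector
      matrix_vector_mult_scale)

lemma rank_one_mult: "rank_one u w ** A = rank_one u (adj A *v w)"
  by (simp add: matrix_eq matrix_vector_mul_assoc[symmetric] rank_one_vector symp_adj)

lemma rank_one_rank_one: "rank_one u w ** rank_one u' w' = mat (symp u' w) ** rank_one u w'"
  by (simp add: matrix_eq matrix_vector_mul_assoc[symmetric] rank_one_vector
      mat_vector_mult matrix_vector_mult_scale symp_scale_left mult.commute)

lemma adj_rank_one: "adj (rank_one u w) = - rank_one w u"
  for u w :: "'n::finite cvec"
proof -
  have left: "A ** (\<chi> a b. p $ a * q $ b) = (\<chi> a b. (A *v p) $ a * q $ b)" for A :: "'n cmat" and p q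
    by (simp add: vec_eq_iff matrix_matrix_mult_def matrix_vector_mult_def sum_distrib_right mult.assoc)
  have right: "(\<chi> a b. p $ a * q $ b) ** A = (\<chi> a b. p $ a * (transpose A *v q) $ b)" for A :: "'n cmat" and p q
    by (simp add: vec_eq_iff matrix_matrix_mult_def matrix_vector_mult_def transpose_def
        sum_distrib_left mult_ac)
  have tr: "transpose (rank_one u w) = (\<chi> a b. (Jmat *v w) $ a * u $ b)"
    by (simp add: rank_one_def transpose_def vec_eq_iff mult.commute)
  show ?thesis
    unfolding adj_def tr left right
    by (simp add: Jmat_vector_Jmat_vector transpose_Jmat uminus_matrix_vector_mult rank_one_def
        vec_eq_iff)
qed


section \<open>Cayley type paths in the stabilizer\<close>

definition sympl_stab :: "'n::finite cmat \<Rightarrow> 'n cmat \<Rightarrow> 'n cvec \<Rightarrow> 'n cmat set" where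
  "sympl_stab s x v = {g. adj g ** g = mat 1 \<and> g ** s = s ** g \<and> g ** x = x ** g \<and> g *v v = v}"

lemma sympl_stab_mult:
  assumes "g \<in> sympl_stab s x v" "h \<in> sympl_stab s x v"
  shows "g ** h \<in> sympl_stab s x v"
proof -
  have "adj (g ** h) ** (g ** h) = adj h ** (adj g ** g) ** h"
    by (simp add: adj_mult matrix_mul_assoc)
  moreover have "g ** h ** y = y ** (g ** h)" if "g ** y = y ** g" "h ** y = y ** h" for y
    by (metis matrix_mul_assoc that)
  ultimately show ?thesis
    using assms by (simp add: sympl_stab_def matrix_vector_mul_assoc[symmetric])
qed

text \<open>The identity lies on the curve of Moebius transforms \<open>(g + t) (1 + t g)\<^sup>-\<^sup>1\<close>, which consists
  of symplectic operators because the adjoint of \<open>g\<close> is its inverse; it runs from \<open>g\<close> at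
  \<open>t = 0\<close> to \<open>1\<close> at \<open>t = 1\<close>, and removing finitely many parameters leaves the plane
  connected.\<close>

lemma connected_component_one_if_invertible:
  fixes s x g :: "'n::finite cmat"
  assumes g: "g \<in> sympl_stab s x v" and inv: "invertible (mat 1 + g)"
  shows "connected_component (sympl_stab s x v) (mat 1) g"
proof -
  define P where "P t = mat 1 + mat t ** g" for t
  define N where "N t = g + mat t" for t
  define I where "I = {t. invertible (P t)}"
  define path where "path t = N t ** matrix_inv (P t)" for t
  have g': "adj g ** g = mat 1" "g ** s = s ** g" "g ** x = x ** g" "g *v v = v"
    using g by (auto simp: sympl_stab_def)
  have "- I = {t. \<not> invertible (mat 1 + mat t ** g)}" by (auto simp: I_def P_def)
  then have "connected (UNIV - (- I))"
    using connected_open_diff_countable[of UNIV "- I"] finite_singular_values[of g]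
    by (simp add: countable_finite connected_UNIV)
  then have "connected I" by (simp add: Diff_eq)
  moreover have "continuous_on I path"
    unfolding path_def
  proof (intro continuous_on_matrix_mult continuous_on_matrix_inv)
    have "continuous_on I (\<lambda>t. if i = j then t else 0)" for i j :: "'n + 'n"
      by (cases "i = j") auto
    then have cont_mat: "continuous_on I (\<lambda>t. mat t :: 'n cmat)"
      unfolding mat_def by (intro continuous_intros)
    show "continuous_on I N" unfolding N_def by (intro continuous_intros cont_mat)
    show "continuous_on I P" unfolding P_def
      by (intro continuous_intros continuous_on_matrix_mult cont_mat)
  qed (simp add: I_def)
  ultimately have "connected (path ` I)" by (rule connected_continuous_image[rotated])
  moreover have "path t \<in> sympl_stab s x v" if "t \<in> I" for t
  proof -
    have P: "invertible (P t)" using that I_def by simp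
    note Pinv = matrix_inv_works[OF P]
    have tg: "g ** mat t = mat t ** g" "adj g ** mat t = mat t ** adj g"
      by (rule times_mat)+
    have adjg: "adj g ** P t = adj (N t)" "adj g ** N t = adj (P t)"
      by (simp_all add: P_def N_def adj_add adj_mat adj_1 adj_scale matrix_distribs
          matrix_mul_assoc tg commute_left[OF tg(1)])
        (simp_all add: matrix_mul_assoc[symmetric] g'(1) add.commute)
    have PN: "P t ** N t = N t ** P t"
      by (simp add: P_def N_def matrix_distribs matrix_mul_assoc tg
          commute_left[OF tg(1)] add_ac)
    have "adj (N t) ** N t = adj g ** (P t ** N t)" by (simp add: adjg(1)[symmetric] matrix_mul_assoc)
    also have "\<dots> = adj (P t) ** P t" by (simp add: PN adjg(2)[symmetric] matrix_mul_assoc)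
    finally have NP: "adj (N t) ** N t = adj (P t) ** P t" .
    have "adj (path t) ** path t = adj (matrix_inv (P t)) ** (adj (N t) ** N t) ** matrix_inv (P t)"
      by (simp add: path_def adj_mult matrix_mul_assoc)
    also have "\<dots> = adj (P t ** matrix_inv (P t)) ** (P t ** matrix_inv (P t))"
      unfolding NP by (simp add: adj_mult matrix_mul_assoc)
    finally have 1: "adj (path t) ** path t = mat 1" by (simp add: Pinv adj_1)
    have 2: "path t ** y = y ** path t" if "g ** y = y ** g" for y
    proof -
      have "P t ** y = y ** P t" "N t ** y = y ** N t"
        by (simp_all add: P_def N_def matrix_distribs matrix_mul_assoc times_mat[of y t])
          (simp_all add: matrix_mul_assoc[symmetric] that)
      then show ?thesis unfolding path_def
        using matrix_inv_commute[OF P, of y] by (simp add: matrix_mul_assoc[symmetric])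
          (simp add: matrix_mul_assoc)
    qed
    have "N t *v v = P t *v v"
      by (simp add: P_def N_def algebra_simps matrix_vector_mul_assoc[symmetric] g'(4))
    moreover have "path t = matrix_inv (P t) ** N t"
      by (simp add: path_def matrix_inv_commute[OF P PN])
    ultimately have "path t *v v = v"
      by (simp add: matrix_vector_mul_assoc[symmetric]) (simp add: matrix_vector_mul_assoc Pinv)
    with 1 2 g' show ?thesis by (simp add: sympl_stab_def)
  qed
  ultimately have con: "connected_component (sympl_stab s x v) (path 1) (path 0)"
    if "0 \<in> I" "1 \<in> I" using that
    unfolding connected_component_def by (intro exI[of _ "path ` I"]) auto
  have P0: "P 0 = mat 1" and P1: "P 1 = mat 1 + g" by (simp_all add: P_def del: mat_0 add: mat_times_0)
  have inv1: "invertible (mat 1 :: 'n cmat)" unfolding invertible_def by (intro exI[of _ "mat 1"]) simp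
  then have "0 \<in> I" "1 \<in> I" using inv inv1 by (simp_all add: I_def P0 P1)
  moreover have "path 0 = g" unfolding path_def N_def P0
    using matrix_inv_works(1)[OF inv1] by simp
  moreover have "path 1 = mat 1" unfolding path_def N_def P1
    using matrix_inv_works(1)[OF inv] by (simp add: add.commute)
  ultimately show ?thesis using con by simp
qed

lemma connected_component_mult_left:
  assumes "g \<in> sympl_stab s x v" "connected_component (sympl_stab s x v) h k"
  shows "connected_component (sympl_stab s x v) (g ** h) (g ** k)"
proof -
  obtain C where C: "connected C" "C \<subseteq> sympl_stab s x v" "h \<in> C" "k \<in> C"
    using assms(2) unfolding connected_component_def by blast
  have "connected ((**) g ` C)"
    by (intro connected_continuous_image C(1) continuous_on_matrix_mult continuous_intros)
  moreover have "(**) g ` C \<subseteq> sympl_stab s x v" using C(2) sympl_stab_mult[OF assms(1)] by auto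
  ultimately show ?thesis unfolding connected_component_def using C(3,4) by blast
qed


section \<open>Eigenvectors of semisimple matrices\<close>

text \<open>Besides an eigenbasis, the lemma bounds the set of all eigenvalues by the diagonal \<open>d\<close>; this
  limits their number by the size of the matrix.\<close>

lemma semisimple_eigenbasis:
  fixes s :: "complex^'k^'k"
  assumes "semisimple s"
  obtains Q :: "complex^'k^'k" and d :: "'k \<Rightarrow> complex" where "invertible Q"
    "\<forall>j. s *v column j Q = d j *s column j Q"
    "\<forall>z a. s *v z = a *s z \<longrightarrow> z \<noteq> 0 \<longrightarrow> a \<in> range d"
proof -
  obtain P :: "complex^'k^'k" where P: "invertible P"
    and diag: "\<And>i j. i \<noteq> j \<Longrightarrow> (P ** s ** matrix_inv P) $ i $ j = 0"
    using assms by (auto simp: semisimple_def simult_diagonalizable_def)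
  define Q where "Q = matrix_inv P"
  define D where "D = P ** s ** Q"
  define d where "d i = D $ i $ i" for i
  have PQ: "P ** Q = mat 1" "Q ** P = mat 1" unfolding Q_def by (rule matrix_inv_works[OF P])+
  have D: "D $ i $ j = (if i = j then d i else 0)" for i j
    using diag by (simp add: D_def Q_def d_def)
  have "Q ** D = (Q ** P) ** s ** Q" by (simp add: D_def matrix_mul_assoc)
  then have QD: "s ** Q = Q ** D" by (simp add: PQ)
  have Dz: "(D *v z) $ i = d i * z $ i" for z i
    by (simp add: matrix_vector_mult_def D if_distrib[where f="\<lambda>x. x * _"] cong: if_cong)
  show ?thesis
  proof
    show "invertible Q" unfolding invertible_def using PQ by blast
    show "\<forall>j. s *v column j Q = d j *s column j Q"
    proof
      fix j
      have "(s ** Q) $ i $ j = d j * Q $ i $ j" for i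
        unfolding QD
        by (simp add: matrix_matrix_mult_def D if_distrib[where f="\<lambda>x. _ * x"] mult.commute
            cong: if_cong)
      then show "s *v column j Q = d j *s column j Q"
        by (simp add: vec_eq_iff column_def matrix_vector_mult_def matrix_matrix_mult_def)
    qed
    show "\<forall>z a. s *v z = a *s z \<longrightarrow> z \<noteq> 0 \<longrightarrow> a \<in> range d"
    proof (intro allI impI)
      fix z a assume z: "s *v z = a *s z" "z \<noteq> 0"
      have "D *v (P *v z) = P *v (s *v ((Q ** P) *v z))"
        by (simp add: D_def matrix_vector_mul_assoc matrix_mul_assoc)
      then have eq: "D *v (P *v z) = a *s (P *v z)"
        by (simp add: PQ z(1) matrix_vector_mult_scale)
      have "Q *v (P *v z) \<noteq> 0" using z(2) by (simp add: matrix_vector_mul_assoc PQ)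
      then have "P *v z \<noteq> 0" by auto
      then obtain i where "(P *v z) $ i \<noteq> 0" by (auto simp: vec_eq_iff)
      moreover have "d i * (P *v z) $ i = a * (P *v z) $ i"
        unfolding Dz[symmetric] eq by simp
      ultimately have "a = d i" by (metis mult_right_cancel)
      then show "a \<in> range d" by simp
    qed
  qed
qed

lemma matrix_eq_0_if_columns:
  fixes A Q :: "complex^'k^'k"
  assumes "invertible Q" "\<And>j. A *v column j Q = 0"
  shows "A = 0"
proof -
  have "(A ** Q) $ i $ j = (A *v column j Q) $ i" for i j
    by (simp add: matrix_matrix_mult_def matrix_vector_mult_def column_def)
  then have "A ** Q = 0" by (simp add: vec_eq_iff assms(2))
  then have "A ** (Q ** matrix_inv Q) = 0" by (simp add: matrix_mul_assoc)
  then show ?thesis by (simp add: matrix_inv_works[OF assms(1)])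
qed

text \<open>Together with the previous lemma this allows nonvanishing of \<open>symp u (A w)\<close>, for nonzero \<open>A\<close>,
  to be tested on eigenvectors of a semisimple matrix.\<close>

lemma symp_nondegenerate_columns:
  assumes "invertible Q" "\<And>j. symp (column j Q) w = 0"
  shows "w = 0"
proof -
  have "(transpose Q *v (Jmat *v w)) $ j = symp (column j Q) w" for j
    by (simp add: symp_def column_def transpose_def matrix_vector_mult_def)
  then have "transpose Q *v (Jmat *v w) = 0" by (simp add: vec_eq_iff assms(2))
  moreover have "transpose (matrix_inv Q) ** transpose Q = mat 1"
    by (simp add: matrix_transpose_mul[symmetric] matrix_inv_works[OF assms(1)] transpose_mat)
  ultimately have "Jmat *v w = 0"
    by (metis matrix_vector_mul_assoc matrix_vector_mul_lid matrix_vector_mult_0_right)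
  then have "Jmat *v (Jmat *v w) = 0" by simp
  then show ?thesis by (simp only: Jmat_vector_Jmat_vector neg_equal_0_iff_equal)
qed


section \<open>Hyperbolic summands\<close>

text \<open>The vectors \<open>U\<close> and \<open>W\<close> form dual bases of two isotropic subspaces, and \<open>p\<close> projects onto the
  span of \<open>U\<close> along the span of \<open>W\<close> and the orthogonal complement of both. Its adjoint is the
  analogous projection onto the span of \<open>W\<close>.\<close>

lemma hyperbolic_projection:
  fixes U W :: "'i \<Rightarrow> 'n::finite cvec"
  assumes "finite I"
    and UW: "\<And>i l. i \<in> I \<Longrightarrow> l \<in> I \<Longrightarrow> symp (U l) (W i) = (if i = l then 1 else 0)"
    and UU: "\<And>i l. i \<in> I \<Longrightarrow> l \<in> I \<Longrightarrow> symp (U i) (U l) = 0"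
    and WW: "\<And>i l. i \<in> I \<Longrightarrow> l \<in> I \<Longrightarrow> symp (W i) (W l) = 0"
  defines "p \<equiv> \<Sum>i\<in>I. rank_one (U i) (W i)"
  shows "p ** p = p" "p ** adj p = 0" "adj p ** p = 0" "l \<in> I \<Longrightarrow> p *v U l = U l"
proof -
  have adjp: "adj p = (\<Sum>i\<in>I. - rank_one (W i) (U i))"
    by (simp add: p_def adj_sum adj_rank_one)
  have "p ** p = (\<Sum>i\<in>I. \<Sum>l\<in>I. mat (symp (U l) (W i)) ** rank_one (U i) (W l))"
    unfolding p_def
    by (subst matrix_sum_rdistrib) (simp add: matrix_sum_ldistrib rank_one_rank_one)
  also have "\<dots> = (\<Sum>i\<in>I. \<Sum>l\<in>I. if i = l then rank_one (U i) (W i) else 0)"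
    by (intro sum.cong refl) (simp add: UW)
  also have "\<dots> = p" using \<open>finite I\<close> by (simp add: p_def)
  finally show "p ** p = p" .
  show "p ** adj p = 0"
    unfolding adjp unfolding p_def
    by (simp add: matrix_sum_ldistrib matrix_sum_rdistrib mat_mult_uminus rank_one_rank_one WW)
  show "adj p ** p = 0"
    unfolding adjp unfolding p_def
    by (simp add: matrix_sum_ldistrib matrix_sum_rdistrib mat_mult_uminus rank_one_rank_one UU)
  show "p *v U l = U l" if "l \<in> I"
  proof -
    have "p *v U l = (\<Sum>i\<in>I. symp (U l) (W i) *s U i)"
      by (simp add: p_def matrix_vector_sum_rdistrib rank_one_vector)
    also have "\<dots> = (\<Sum>i\<in>I. if i = l then U l else 0)"
      using that by (intro sum.cong refl) (simp add: UW)
    finally show ?thesis using \<open>finite I\<close> that by simp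
  qed
qed

text \<open>Here \<open>x\<close> is the self-adjoint operator that a suitable representative of the bivector
  component of a parameter becomes when the form identifies the vector space with its dual.\<close>

locale exotic_pair =
  fixes s x :: "'n::finite cmat" and q :: complex
  assumes adj_s: "adj s ** s = mat 1"
    and semisimple_s: "semisimple s"
    and adj_x: "adj x = x"
    and s_x: "s ** x = mat q ** (x ** s)"
    and q_powers: "\<And>k. 1 \<le> k \<Longrightarrow> k \<le> 2 * CARD('n) \<Longrightarrow> q ^ k \<noteq> 1"
begin

lemma s_adj: "s ** adj s = mat 1"
  using adj_s matrix_left_right_inverse by blast

lemma q_nonzero_if: "x \<noteq> 0 \<Longrightarrow> q \<noteq> 0"
proof
  assume "x \<noteq> 0" "q = 0"
  then have "s ** x = 0" using s_x by (simp del: mat_0 add: mat_times_0)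
  then have "adj s ** s ** x = 0" by (simp add: matrix_mul_assoc[symmetric])
  with \<open>x \<noteq> 0\<close> show False by (simp add: adj_s)
qed

lemma eigenvector_shift:
  assumes "s *v z = a *s z"
  shows "s *v (mpow x m *v z) = (a * q ^ m) *s (mpow x m *v z)"
proof (induction m)
  case (Suc m)
  have "s *v (mpow x (Suc m) *v z) = (s ** x) *v (mpow x m *v z)"
    by (simp add: matrix_vector_mul_assoc matrix_mul_assoc)
  also have "\<dots> = q *s (x *v (s *v (mpow x m *v z)))"
    unfolding s_x by (simp add: matrix_vector_mul_assoc[symmetric] mat_vector_mult)
  finally have "s *v (mpow x (Suc m) *v z) = q *s (x *v ((a * q ^ m) *s (mpow x m *v z)))"
    by (simp only: Suc)
  then show ?case
    by (simp add: matrix_vector_mult_scale matrix_vector_mul_assoc mult_ac)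
qed (simp add: assms)

lemma eigenvalue_nonzero:
  assumes "s *v z = a *s z" "z \<noteq> 0"
  shows "a \<noteq> 0"
proof
  assume "a = 0"
  then have "adj s *v (s *v z) = 0" using assms by simp
  then show False using assms(2) by (simp add: matrix_vector_mul_assoc adj_s)
qed

text \<open>If \<open>x\<^sup>m z \<noteq> 0\<close> for an \<open>s\<close>-eigenvector \<open>z\<close> with eigenvalue \<open>a\<close> and all \<open>m \<le> 2n\<close>, then \<open>s\<close> has
  the \<open>2n + 1\<close> distinct eigenvalues \<open>a q\<^sup>m\<close>, too many for dimension \<open>2n\<close>.\<close>

lemma x_nilpotent: "mpow x (2 * CARD('n)) = 0"
proof (cases "x = 0")
  case True
  then show ?thesis by (cases "2 * CARD('n)") auto
next
  case False
  then have q0: "q \<noteq> 0" by (rule q_nonzero_if)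
  let ?N = "2 * CARD('n)"
  obtain Q :: "'n cmat" and d where Q: "invertible Q" "\<forall>j. s *v column j Q = d j *s column j Q"
    "\<forall>z a. s *v z = a *s z \<longrightarrow> z \<noteq> 0 \<longrightarrow> a \<in> range d"
    by (rule semisimple_eigenbasis[OF semisimple_s])
  have "mpow x ?N *v column j Q = 0" for j
  proof (rule ccontr)
    let ?z = "column j Q" and ?a = "d j"
    assume nz: "mpow x ?N *v ?z \<noteq> 0"
    have nz': "mpow x m *v ?z \<noteq> 0" if "m \<le> ?N" for m
    proof
      assume "mpow x m *v ?z = 0"
      then have "mpow x (?N - m) *v (mpow x m *v ?z) = 0" by simp
      then have "mpow x ?N *v ?z = 0" using that by (simp add: matrix_vector_mul_assoc mpow_add[symmetric])
      with nz show False by simp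
    qed
    have a0: "?a \<noteq> 0"
      by (rule eigenvalue_nonzero[OF Q(2)[rule_format, of j]]) (use nz'[of 0] in simp)
    have "inj_on (\<lambda>m. ?a * q ^ m) {..?N}"
    proof (rule linorder_inj_onI')
      fix m m' assume m: "m \<in> {..?N}" "m' \<in> {..?N}" "m < m'"
      then have "q ^ (m' - m) \<noteq> 1" by (intro q_powers) auto
      then have "q ^ m * q ^ (m' - m) \<noteq> q ^ m * 1" using q0 by simp
      then show "?a * q ^ m \<noteq> ?a * q ^ m'"
        using m(3) a0 by (simp add: power_add[symmetric])
    qed
    then have "?N + 1 = card ((\<lambda>m. ?a * q ^ m) ` {..?N})" by (simp add: card_image)
    also have "\<dots> \<le> card (range d)"
      using Q(3)[rule_format, OF eigenvector_shift[OF Q(2)[rule_format, of j]] nz'] by (intro card_mono) auto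
    also have "\<dots> \<le> CARD('n + 'n)" 
      using card_image_le[of "UNIV :: ('n + 'n) set" d] by simp
    finally show False by simp
  qed
  then show ?thesis using matrix_eq_0_if_columns[OF Q(1)] by blast
qed

text \<open>These idempotents are the orthogonal projections onto the nondegenerate subspaces that are
  stable under \<open>s\<close> and \<open>x\<close>.\<close>

definition invariant_idempotent :: "'n cmat \<Rightarrow> bool" where
  "invariant_idempotent e \<longleftrightarrow> e ** e = e \<and> adj e = e \<and> e ** s = s ** e \<and> e ** x = x ** e"

text \<open>Such a \<open>j\<close> is a symplectic square root of \<open>-1\<close> on the image of \<open>e\<close>; its eigenspaces for
  \<open>\<i>\<close> and \<open>-\<i>\<close> are complementary Lagrangian subspaces stable under \<open>s\<close> and \<open>x\<close>.\<close>

definition imaginary_unit :: "'n cmat \<Rightarrow> 'n cmat \<Rightarrow> bool" where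
  "imaginary_unit e j \<longleftrightarrow> e ** j = j \<and> j ** e = j \<and> adj j = - j \<and> j ** j = - e \<and>
    j ** s = s ** j \<and> j ** x = x ** j"

text \<open>With \<open>k\<close> the nilpotency index of \<open>x\<close> on the image of \<open>e\<close>, the form
  \<open>symp u (x\<^sup>k\<^sup>-\<^sup>1 w)\<close> is nonzero there. As \<open>s\<close>-eigenvectors span, it is nonzero on a pair of them.\<close>

lemma hyperbolic_pair_exists:
  assumes e: "invariant_idempotent e" and "e \<noteq> 0"
  obtains k a b u w where "0 < k" "k \<le> 2 * CARD('n)"
    "e *v u = u" "e *v w = w" "s *v u = a *s u" "s *v w = b *s w"
    "symp u (mpow x (k - 1) *v w) = 1"
    "mpow x k *v u = 0" "mpow x k *v w = 0"
proof -
  note e' = e[unfolded invariant_idempotent_def]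
  define k where "k = (LEAST k. mpow x k ** e = 0)"
  have xN: "mpow x (2 * CARD('n)) ** e = 0" by (simp add: x_nilpotent)
  have xk: "mpow x k ** e = 0" unfolding k_def by (rule LeastI[of "\<lambda>k. mpow x k ** e = 0", OF xN])
  have kN: "k \<le> 2 * CARD('n)" unfolding k_def by (rule Least_le[of "\<lambda>k. mpow x k ** e = 0", OF xN])
  have k0: "0 < k" using xk \<open>e \<noteq> 0\<close> by (cases k) auto
  define E where "E = mpow x (k - 1) ** e"
  have "E \<noteq> 0" unfolding E_def using not_less_Least[of "k - 1" "\<lambda>k. mpow x k ** e = 0"] k0
    by (auto simp: k_def)
  have ex: "mpow x (k - 1) ** e = e ** mpow x (k - 1)" using mpow_commute e' by metis
  have eE: "e ** E = E" unfolding E_def ex using e' by (simp add: matrix_mul_assoc)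
  obtain Q :: "'n cmat" and d where Q: "invertible Q" "\<forall>j. s *v column j Q = d j *s column j Q"
    by (rule semisimple_eigenbasis[OF semisimple_s])
  obtain i j where ij: "symp (column i Q) (E *v column j Q) \<noteq> 0"
    using \<open>E \<noteq> 0\<close> matrix_eq_0_if_columns[OF Q(1)] symp_nondegenerate_columns[OF Q(1)] by metis
  define c where "c = symp (column i Q) (E *v column j Q)"
  define u where "u = e *v column i Q"
  define w where "w = (1 / c) *s (e *v column j Q)"
  have eig: "s *v (e *v column l Q) = d l *s (e *v column l Q)" for l
  proof -
    have "s *v (e *v column l Q) = e *v (s *v column l Q)"
      using e' by (simp add: matrix_vector_mul_assoc)
    then show ?thesis by (simp add: Q(2)[rule_format] matrix_vector_mult_scale)
  qed
  have "symp u (mpow x (k - 1) *v w) = (1 / c) * symp (e *v column i Q) (E *v column j Q)"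
    by (simp add: u_def w_def E_def matrix_vector_mult_scale symp_scale_right matrix_vector_mul_assoc)
  also have "\<dots> = (1 / c) * symp (column i Q) ((e ** E) *v column j Q)"
    using e' by (simp add: symp_adj matrix_vector_mul_assoc)
  also have "\<dots> = 1" using ij by (simp add: eE c_def)
  finally have "symp u (mpow x (k - 1) *v w) = 1" .
  moreover have "e *v u = u" "e *v w = w"
    using e' by (simp_all add: u_def w_def matrix_vector_mult_scale matrix_vector_mul_assoc)
  moreover have "s *v u = d i *s u" "s *v w = d j *s w"
    by (simp_all add: u_def w_def matrix_vector_mult_scale eig mult.commute)
  moreover have "mpow x k *v u = 0" "mpow x k *v w = 0"
    using xk by (simp_all add: u_def w_def matrix_vector_mult_scale matrix_vector_mul_assoc)
  ultimately show ?thesis using that k0 kN by blast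
qed

text \<open>The cyclic \<open>x\<close>-modules generated by the vectors \<open>u\<close> and \<open>w\<close> of the previous lemma are isotropic
  because \<open>x\<close> is self-adjoint and the form alternating. They are in duality: comparing the
  \<open>s\<close>-weights, \<open>symp u (x\<^sup>m w)\<close> can be nonzero only if \<open>a b q\<^sup>m = 1\<close>. As \<open>m = k - 1\<close> satisfies
  this equation and \<open>q\<close> is no root of unity of small order, no smaller \<open>m\<close> does.\<close>

lemma isotropic_projection_exists:
  assumes e: "invariant_idempotent e" and "e \<noteq> 0"
  obtains p where "p ** p = p" "p ** adj p = 0" "adj p ** p = 0" "p \<noteq> 0"
    "e ** p = p" "p ** e = p" "p ** s = s ** p" "p ** x = x ** p"
proof -
  obtain k a b u w where k: "0 < k" "k \<le> 2 * CARD('n)"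
    and eu: "e *v u = u" "e *v w = w" and su: "s *v u = a *s u" "s *v w = b *s w"
    and uw: "symp u (mpow x (k - 1) *v w) = 1"
    and xk: "mpow x k *v u = 0" "mpow x k *v w = 0"
    by (rule hyperbolic_pair_exists[OF assms])
  note e' = e[unfolded invariant_idempotent_def]
  define U where "U i = mpow x i *v u" for i
  define W where "W i = mpow x (k - 1 - i) *v w" for i
  have symp_x: "symp (mpow x i *v y) (mpow x l *v z) = symp y (mpow x (i + l) *v z)" for i l y z
    by (simp add: symp_adj adj_mpow adj_x matrix_vector_mul_assoc mpow_add)
  have weight: "a * b * q ^ m = 1" if "symp u (mpow x m *v w) \<noteq> 0" for m
  proof -
    have "symp u (mpow x m *v w) = symp (s *v u) (s *v (mpow x m *v w))"
      by (simp add: symp_adj matrix_vector_mul_assoc matrix_mul_assoc adj_s)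
    also have "\<dots> = a * b * q ^ m * symp u (mpow x m *v w)"
      by (simp add: su eigenvector_shift[OF su(2)] symp_scale_left symp_scale_right mult_ac)
    finally show ?thesis using that by simp
  qed
  have ab: "a * b * q ^ (k - 1) = 1" using weight uw by simp
  have dual: "symp u (mpow x m *v w) = (if m = k - 1 then 1 else 0)" for m
  proof -
    consider "m = k - 1" | "k \<le> m" | "m < k - 1" using k(1) by linarith
    then show ?thesis
    proof cases
      case 2
      then have "mpow x m *v w = mpow x (m - k) *v (mpow x k *v w)"
        by (simp add: matrix_vector_mul_assoc mpow_add[symmetric])
      then show ?thesis using 2 k(1) by (simp add: xk symp_0_right)
    next
      case 3
      have "symp u (mpow x m *v w) = 0"
      proof (rule ccontr)
        assume "symp u (mpow x m *v w) \<noteq> 0"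
        then have "a * b * q ^ m = 1" by (rule weight)
        moreover have "a * b * q ^ m * q ^ (k - 1 - m) = 1"
          using ab 3 by (simp add: mult.assoc power_add[symmetric])
        ultimately have "q ^ (k - 1 - m) = 1" by simp
        moreover have "q ^ (k - 1 - m) \<noteq> 1" using 3 k(2) by (intro q_powers) auto
        ultimately show False by simp
      qed
      then show ?thesis using 3 by simp
    qed (use uw in simp)
  qed
  have isotropic: "symp (mpow x i *v y) (mpow x l *v y) = 0" for i l y
  proof -
    have "symp (mpow x i *v y) (mpow x l *v y) = symp (mpow x l *v y) (mpow x i *v y)"
      by (simp add: symp_x add.commute)
    then show ?thesis using symp_skew[of "mpow x l *v y"] by simp
  qed
  define p where "p = (\<Sum>i<k. rank_one (U i) (W i))"
  have p: "p ** p = p" "p ** adj p = 0" "adj p ** p = 0" "\<And>l. l < k \<Longrightarrow> p *v U l = U l"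
    unfolding p_def
    by (rule hyperbolic_projection; auto simp: U_def W_def isotropic symp_x dual)+
  have "U 0 \<noteq> 0" using uw by (auto simp: U_def symp_def)
  with p(4)[of 0] k(1) have "p \<noteq> 0" by auto
  have ex: "e *v (mpow x i *v z) = mpow x i *v z" if "e *v z = z" for i z
  proof -
    have "e *v (mpow x i *v z) = mpow x i *v (e *v z)"
      using mpow_commute[of x e i] e' by (simp add: matrix_vector_mul_assoc)
    then show ?thesis by (simp add: that)
  qed
  have "e ** p = p" "p ** e = p"
    using e' eu by (simp_all add: p_def matrix_sum_ldistrib matrix_sum_rdistrib mult_rank_one
        rank_one_mult U_def W_def ex)
  moreover have "p ** s = s ** p"
    unfolding p_def matrix_sum_ldistrib matrix_sum_rdistrib
  proof (rule sum.cong[OF refl])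
    fix i assume "i \<in> {..<k}"
    then have "a * q ^ i * (b * q ^ (k - 1 - i)) = 1"
      using ab by (simp add: mult_ac power_add[symmetric])
    moreover have "(b * q ^ (k - 1 - i)) *s (adj s *v W i) = W i"
    proof -
      have "adj s *v (s *v W i) = W i" by (simp add: matrix_vector_mul_assoc adj_s)
      then show ?thesis by (simp add: W_def eigenvector_shift[OF su(2)] matrix_vector_mult_scale)
    qed
    ultimately have "adj s *v W i = (a * q ^ i) *s W i"
      by (metis mult.commute vector_smult_assoc vector_smult_lid)
    then show "rank_one (U i) (W i) ** s = s ** rank_one (U i) (W i)"
      by (simp add: rank_one_mult mult_rank_one U_def eigenvector_shift[OF su(1)] rank_one_scale)
  qed
  moreover have "p ** x = x ** p"
  proof -
    \<comment> \<open>The two sums are shifts of each other, and the boundary terms contain \<open>x\<^sup>k u\<close> or \<open>x\<^sup>k w\<close>.\<close>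
    let ?F = "\<lambda>i. rank_one (mpow x i *v u) (mpow x (k - i) *v w)"
    have "p ** x = (\<Sum>i<k. ?F i)"
      unfolding p_def matrix_sum_rdistrib
    proof (rule sum.cong[OF refl])
      fix i assume "i \<in> {..<k}"
      then have "k - i = Suc (k - 1 - i)" by auto
      then show "rank_one (U i) (W i) ** x = ?F i"
        by (simp add: rank_one_mult adj_x U_def W_def matrix_vector_mul_assoc)
    qed
    moreover have "x ** p = (\<Sum>i<k. ?F (Suc i))"
      by (simp add: p_def matrix_sum_ldistrib mult_rank_one U_def W_def matrix_vector_mul_assoc)
    moreover have "?F 0 + (\<Sum>i<k. ?F (Suc i)) = (\<Sum>i<k. ?F i) + ?F k"
      by (rule trans[OF sum.lessThan_Suc_shift[of ?F k, symmetric] sum.lessThan_Suc])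
    moreover have "?F 0 = 0" "?F k = 0" by (simp_all add: xk rank_one_0)
    ultimately show ?thesis by simp
  qed
  ultimately show ?thesis using that p(1-3) \<open>p \<noteq> 0\<close> by blast
qed

text \<open>On the sum of the two isotropic modules, \<open>j\<close> acts by \<open>\<i>\<close> on the first and by \<open>-\<i>\<close> on the
  second.\<close>

lemma imaginary_unit_summand:
  assumes e: "invariant_idempotent e" and "e \<noteq> 0"
  obtains f j where "invariant_idempotent f" "imaginary_unit f j" "e ** f = f" "f ** e = f" "f \<noteq> 0"
proof -
  obtain p where p: "p ** p = p" "p ** adj p = 0" "adj p ** p = 0" "p \<noteq> 0"
    "e ** p = p" "p ** e = p" "p ** s = s ** p" "p ** x = x ** p"
    by (rule isotropic_projection_exists[OF assms])
  have "adj e = e" using e by (simp add: invariant_idempotent_def)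
  then have adjp: "adj p ** adj p = adj p" "adj p ** e = adj p" "e ** adj p = adj p"
    "adj p ** x = x ** adj p"
    using arg_cong[OF p(1), of adj] arg_cong[OF p(5), of adj] arg_cong[OF p(6), of adj]
      arg_cong[OF p(8), of adj]
    unfolding adj_mult adj_x by simp_all
  have "adj s ** adj p = adj p ** adj s" using arg_cong[OF p(7), of adj] by (simp add: adj_mult)
  then have "s ** (adj s ** adj p) ** s = s ** (adj p ** adj s) ** s" by simp
  then have "(s ** adj s) ** adj p ** s = s ** adj p ** (adj s ** s)"
    by (simp add: matrix_mul_assoc)
  then have adjps: "adj p ** s = s ** adj p" by (simp add: adj_s s_adj)
  define f where "f = p + adj p"
  define j where "j = mat \<i> ** (p - adj p)"
  have "f ** p = p" by (simp add: f_def matrix_distribs p)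
  then have "f \<noteq> 0" using p(4) by auto
  moreover have "invariant_idempotent f"
    by (simp add: invariant_idempotent_def f_def matrix_distribs p adjp adjps adj_add adj_adj add.commute)
  moreover have "imaginary_unit f j"
  proof -
    let ?D = "p - adj p"
    have D: "?D ** ?D = f" "f ** ?D = ?D" "?D ** f = ?D" "?D ** s = s ** ?D" "?D ** x = x ** ?D"
      by (simp_all add: f_def matrix_distribs p adjp adjps)
    have "j ** j = mat \<i> ** (mat \<i> ** (?D ** ?D))"
      unfolding j_def by (simp only: matrix_mul_assoc[symmetric] mult_mat_times[of ?D])
    also have "\<dots> = - f"
      unfolding mat_times_mat D by (simp add: vec_eq_iff mat_times_component)
    finally have "j ** j = - f" .
    moreover have "f ** j = j" "j ** f = j" "j ** s = s ** j" "j ** x = x ** j"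
      unfolding j_def
      by (simp_all only: matrix_mul_assoc[symmetric] mult_mat_times[of f] mult_mat_times[of s]
          mult_mat_times[of x] D)
    moreover have "adj j = - j"
      by (simp add: j_def adj_scale adj_diff adj_adj matrix_distribs)
    ultimately show ?thesis by (simp add: imaginary_unit_def)
  qed
  moreover have "e ** f = f" "f ** e = f" by (simp_all add: f_def matrix_distribs p adjp)
  ultimately show ?thesis using that by blast
qed

text \<open>Orthogonal summands are split off one after the other, by induction on the dimension of the
  image of \<open>e\<close>.\<close>

lemma imaginary_unit_exists:
  assumes "invariant_idempotent e"
  shows "\<exists>j. imaginary_unit e j"
  using assms
proof (induction "dim {z. e *v z = z}" arbitrary: e rule: less_induct)
  case less
  show ?case
  proof (cases "e = 0")
    case True
    then show ?thesis by (intro exI[of _ 0]) (simp add: imaginary_unit_def adj_0)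
  next
    case False
    obtain f j where f: "invariant_idempotent f" "e ** f = f" "f ** e = f" "f \<noteq> 0"
      and j: "imaginary_unit f j"
      by (rule imaginary_unit_summand[OF less.prems False])
    note e' = less.prems[unfolded invariant_idempotent_def]
      and f' = f(1)[unfolded invariant_idempotent_def]
    define e1 where "e1 = e - f"
    have e1: "invariant_idempotent e1"
      using e' f' by (simp add: invariant_idempotent_def e1_def matrix_distribs f adj_diff)
    have e1_prods: "e1 ** f = 0" "f ** e1 = 0" "e1 ** e = e1" "e ** e1 = e1"
      using e' f' by (simp_all add: e1_def matrix_distribs f)
    have "A *v (c *\<^sub>R z) = c *\<^sub>R (A *v z)" for A :: "'n cmat" and c z
      by (simp add: vec_eq_iff matrix_vector_mult_def scaleR_sum_right)
    then have subsp: "subspace {z. A *v z = z}" for A :: "'n cmat"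
      by (simp add: subspace_def matrix_vector_right_distrib)
    have "{z. e1 *v z = z} \<subset> {z. e *v z = z}"
    proof (rule psubsetI)
      have "e *v z = z" if "e1 *v z = z" for z
      proof -
        have "e *v (e1 *v z) = e1 *v z" by (simp add: matrix_vector_mul_assoc e1_prods)
        then show ?thesis by (simp add: that)
      qed
      then show "{z. e1 *v z = z} \<subseteq> {z. e *v z = z}" by blast
      obtain z where z: "f *v z \<noteq> 0" using f(4) by (metis matrix_eq matrix_vector_mult_0)
      have "e *v (f *v z) = f *v z" by (simp add: matrix_vector_mul_assoc f)
      moreover have "e1 *v (f *v z) = 0" by (simp add: matrix_vector_mul_assoc e1_prods)
      ultimately have "f *v z \<in> {z. e *v z = z}" "f *v z \<notin> {z. e1 *v z = z}" using z by auto
      then show "{z. e1 *v z = z} \<noteq> {z. e *v z = z}" by blast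
    qed
    then have "dim {z. e1 *v z = z} < dim {z. e *v z = z}"
      by (intro dim_psubset) (simp only: span_eq_iff[THEN iffD2, OF subsp])
    then obtain j1 where j1: "imaginary_unit e1 j1" using less.hyps e1 by blast
    note j' = j[unfolded imaginary_unit_def] and j1' = j1[unfolded imaginary_unit_def]
    have absorb: "f ** j = j" "j ** f = j" "e1 ** j1 = j1" "j1 ** e1 = j1" using j' j1' by auto
    have "(j ** f) ** (e1 ** j1) = j ** (f ** e1) ** j1" "(j1 ** e1) ** (f ** j) = j1 ** (e1 ** f) ** j"
      by (simp_all only: matrix_mul_assoc)
    then have jj1: "j ** j1 = 0" "j1 ** j = 0" unfolding absorb e1_prods by simp_all
    have "(e ** f) ** j = e ** (f ** j)" "(j ** f) ** e = j ** (f ** e)"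
      "(e ** e1) ** j1 = e ** (e1 ** j1)" "(j1 ** e1) ** e = j1 ** (e1 ** e)"
      by (simp_all only: matrix_mul_assoc)
    then have ej: "e ** j = j" "j ** e = j" "e ** j1 = j1" "j1 ** e = j1"
      unfolding f absorb e1_prods by simp_all
    have "imaginary_unit e (j + j1)"
      using j' j1' by (simp add: imaginary_unit_def matrix_distribs ej jj1 adj_add) (simp add: e1_def)
    then show ?thesis by blast
  qed
qed



section \<open>Connectedness of the stabilizer\<close>

text \<open>The projection \<open>e\<close> onto the generalized eigenspace of \<open>g\<close> for \<open>-1\<close> is self-adjoint because the
  adjoint of \<open>g\<close> is its inverse and \<open>-1\<close> is its own inverse. Its values on
  eigenvectors for \<open>-1\<close> and \<open>1\<close> serve to show that \<open>1 + g (1 - 2 e)\<close> is invertible and that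
  \<open>e v = 0\<close>.\<close>

lemma spectral_idempotent:
  assumes g: "g \<in> sympl_stab s x v"
  obtains e where "invariant_idempotent e" "e ** g = g ** e"
    "\<forall>z. g *v z = - z \<longrightarrow> e *v z = z" "\<forall>z. g *v z = z \<longrightarrow> e *v z = 0"
proof -
  note g' = g[unfolded sympl_stab_def, simplified]
  define A where "A = mat 1 + g"
  obtain e r S where ee: "e ** e = e" and Ae: "mpow A (Suc r) ** e = 0"
    and S: "mat 1 - e = S ** mpow A (Suc r)"
    and comm: "\<forall>B. A ** B = B ** A \<longrightarrow> e ** B = B ** e" "\<forall>B. A ** B = B ** A \<longrightarrow> S ** B = B ** S"
    by (rule fitting_idempotent)
  define Y where "Y = mpow A (Suc r)"
  have A_comm: "A ** B = B ** A" if "g ** B = B ** g" for B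
    by (simp add: A_def matrix_distribs that)
  have e_comm: "e ** B = B ** e" if "g ** B = B ** g" for B
    using comm(1) A_comm[OF that] by blast
  have "A ** A = A ** A" ..
  then have "S ** Y = Y ** S" unfolding Y_def
    using comm(2) mpow_commute[of A A "Suc r"] by metis
  then have S': "mat 1 - e = Y ** S" using S by (simp add: Y_def)
  have eY: "e ** Y = 0"
    unfolding Y_def using Ae comm(1) mpow_commute[of A A "Suc r"] by metis
  have "adj e = e"
  proof -
    have gg: "g ** adj g = adj g ** g" using g' matrix_left_right_inverse by metis
    \<comment> \<open>The adjoint of \<open>A = 1 + g\<close> is \<open>g\<^sup>-\<^sup>1 A\<close>, so that powers of \<open>A\<close> and of its adjoint have the same kernel.\<close>
    have adjA: "adj A ** g = A" "g ** adj A = adj A ** g"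
      by (simp_all add: A_def adj_add adj_1 matrix_distribs g' gg add.commute)
    have "mpow (adj A) m ** mpow g m = mpow A m" for m
    proof (induction m)
      case (Suc m)
      have "mpow (adj A) (Suc m) ** mpow g (Suc m) = adj A ** (mpow (adj A) m ** g) ** mpow g m"
        by (simp add: matrix_mul_assoc)
      also have "mpow (adj A) m ** g = g ** mpow (adj A) m"
        by (rule mpow_commute) (simp add: adjA(2))
      also have "adj A ** (g ** mpow (adj A) m) ** mpow g m = (adj A ** g) ** (mpow (adj A) m ** mpow g m)"
        by (simp add: matrix_mul_assoc)
      finally show ?case by (simp add: Suc adjA(1))
    qed simp
    then have Y: "adj Y ** mpow g (Suc r) = Y" by (simp only: Y_def adj_mpow)
    have "adj e ** adj Y = 0"
      using arg_cong[OF Ae, of adj] by (simp only: Y_def adj_mult adj_0)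
    then have "adj e ** adj Y ** mpow g (Suc r) = 0" by simp
    then have "adj e ** Y = 0" by (simp only: matrix_mul_assoc[symmetric] Y)
    then have "adj e ** (mat 1 - e) = 0" by (simp add: S' matrix_mul_assoc)
    then have ade: "adj e = adj e ** e" by (simp add: matrix_distribs)
    then have "e = adj (adj e ** e)" by (metis adj_adj)
    also have "\<dots> = adj e ** e" by (simp add: adj_mult adj_adj)
    finally show ?thesis using ade by simp
  qed
  then have "invariant_idempotent e"
    using ee e_comm[of s] e_comm[of x] g' unfolding invariant_idempotent_def by blast
  moreover have "e *v z = z" if "g *v z = - z" for z
  proof -
    have "A *v z = 0" by (simp add: A_def matrix_vector_mult_add_rdistrib that)
    then have "Y *v z = 0"
      by (simp only: Y_def mpow_Suc_right matrix_vector_mul_assoc[symmetric] matrix_vector_mult_0_right)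
    then have "(mat 1 - e) *v z = 0"
      unfolding S Y_def[symmetric] by (simp add: matrix_vector_mul_assoc[symmetric])
    then show ?thesis by (simp add: matrix_vector_mult_diff_rdistrib)
  qed
  moreover have "e *v z = 0" if "g *v z = z" for z
  proof -
    have "A *v z = 2 *s z" by (simp add: A_def matrix_vector_mult_add_rdistrib that vec_eq_iff)
    then have Yz: "Y *v z = 2 ^ Suc r *s z" unfolding Y_def by (rule mpow_eigenvector)
    have "e *v (Y *v z) = 0" by (simp add: matrix_vector_mul_assoc eY)
    then have "2 ^ Suc r *s (e *v z) = 0" by (simp only: Yz matrix_vector_mult_scale)
    then show ?thesis by (simp add: vec_eq_iff)
  qed
  ultimately show ?thesis using that e_comm[of g] by blast
qed

text \<open>For \<open>g\<close> in the stabilizer, multiplication by the involution \<open>1 - 2 e\<close> removes the eigenvalue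
  \<open>-1\<close>, and the involution is the square of \<open>h = (1 - e) + j\<close>, whose eigenvalues are \<open>1\<close>, \<open>\<i>\<close> and
  \<open>-\<i>\<close>. Both \<open>g (1 - 2 e)\<close> and \<open>h\<close> are therefore joined to \<open>1\<close> by a curve of Moebius transforms.
  They fix \<open>v\<close> because \<open>e\<close> and \<open>j = j e\<close> kill it.\<close>

lemma connected_sympl_stab: "connected (sympl_stab s x v)"
proof -
  let ?H = "sympl_stab s x v"
  have "connected_component ?H (mat 1) g" if g: "g \<in> ?H" for g
  proof -
    note g' = g[unfolded sympl_stab_def, simplified]
    obtain e where e: "invariant_idempotent e" and eg: "e ** g = g ** e"
      and minus: "\<forall>z. g *v z = - z \<longrightarrow> e *v z = z" and plus: "\<forall>z. g *v z = z \<longrightarrow> e *v z = 0"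
      by (rule spectral_idempotent[OF g])
    note e' = e[unfolded invariant_idempotent_def]
    have ev: "e *v v = 0" using plus g' by blast
    obtain j where j: "imaginary_unit e j" using imaginary_unit_exists[OF e] by blast
    note j' = j[unfolded imaginary_unit_def]
    have "j *v v = (j ** e) *v v" using j' by simp
    then have jv: "j *v v = 0" by (simp add: matrix_vector_mul_assoc[symmetric] ev)
    define h where "h = mat 1 - e + j"
    define h2 where "h2 = mat 1 - e - e"
    define k where "k = g ** h2"
    have hh: "h ** h = h2" using e' j' by (simp add: h_def h2_def matrix_distribs)
    have h: "h \<in> ?H"
      using e' j' by (simp add: sympl_stab_def h_def adj_add adj_diff adj_1 matrix_distribs
          matrix_vector_mult_add_rdistrib matrix_vector_mult_diff_rdistrib ev jv)
    then have h2: "h2 \<in> ?H" using sympl_stab_mult hh by metis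
    have "h ** j = - e" using j' by (simp add: h_def matrix_distribs)
    then have "(mat 1 + h) ** (mat 1 - j) = mat 1 + h - (j - e)" by (simp add: matrix_distribs)
    also have "\<dots> = mat 1 + mat 1" by (simp add: h_def)
    also have "\<dots> = mat 2" by (simp add: mat_def vec_eq_iff)
    finally have "(mat 1 + h) ** (mat (1 / 2) ** (mat 1 - j)) = mat (1 / 2) ** (mat 2 ** mat 1)"
      by (simp add: mult_mat_times)
    then have "(mat 1 + h) ** (mat (1 / 2) ** (mat 1 - j)) = mat 1"
      unfolding mat_times_mat by simp
    then have "invertible (mat 1 + h)" using invertible_right_inverse by blast
    then have "connected_component ?H (mat 1) h" by (rule connected_component_one_if_invertible[OF h])
    moreover from connected_component_mult_left[OF h this] have "connected_component ?H h h2"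
      by (simp add: hh)
    ultimately have 1: "connected_component ?H (mat 1) h2" by (rule connected_component_trans)
    have k: "k \<in> ?H" unfolding k_def by (rule sympl_stab_mult[OF g h2])
    have "z = 0" if z: "(mat 1 + k) *v z = 0" for z
    proof -
      have "(mat 1 - e) ** (mat 1 + k) = (mat 1 + g) ** (mat 1 - e)" "e ** (mat 1 + k) = (mat 1 - g) ** e"
      proof -
        have h2e: "(mat 1 - e) ** h2 = mat 1 - e" "e ** h2 = - e"
          using e' by (simp_all only: h2_def matrix_distribs matrix_mul_lid matrix_mul_rid) simp_all
        have "(mat 1 - e) ** g = g ** (mat 1 - e)" by (simp add: matrix_distribs eg)
        then have "(mat 1 - e) ** k = g ** (mat 1 - e)" "e ** k = - (g ** e)"
          by (simp_all add: k_def matrix_mul_assoc eg)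
            (simp_all add: matrix_mul_assoc[symmetric] h2e mat_mult_uminus)
        then show "(mat 1 - e) ** (mat 1 + k) = (mat 1 + g) ** (mat 1 - e)"
          "e ** (mat 1 + k) = (mat 1 - g) ** e"
          by (simp_all add: matrix_add_ldistrib[of _ "mat 1"] matrix_add_rdistrib matrix_diff_rdistrib[of "mat 1"])
      qed
      then have *: "(mat 1 + g) *v ((mat 1 - e) *v z) = 0" "(mat 1 - g) *v (e *v z) = 0"
        using z by (metis matrix_vector_mul_assoc matrix_vector_mult_0_right)+
      have "g *v ((mat 1 - e) *v z) = - ((mat 1 - e) *v z)"
        using *(1) by (simp add: matrix_vector_mult_add_rdistrib add_eq_0_iff)
      then have "e *v ((mat 1 - e) *v z) = (mat 1 - e) *v z" using minus by blast
      moreover have "e ** (mat 1 - e) = 0" using e' by (simp add: matrix_distribs)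
      ultimately have "(mat 1 - e) *v z = 0" by (simp add: matrix_vector_mul_assoc)
      moreover have "g *v (e *v z) = e *v z"
        using *(2) by (simp add: matrix_vector_mult_diff_rdistrib)
      then have "e *v (e *v z) = 0" using plus by blast
      then have "e *v z = 0" using e' by (simp add: matrix_vector_mul_assoc)
      ultimately show ?thesis by (simp add: matrix_vector_mult_diff_rdistrib)
    qed
    then have "invertible (mat 1 + k)"
      using matrix_left_invertible_ker invertible_left_inverse by blast
    then have "connected_component ?H (mat 1) k" by (rule connected_component_one_if_invertible[OF k])
    moreover have "connected_component ?H k (k ** h2)"
      using connected_component_mult_left[OF k 1] by simp
    moreover have "k ** h2 = g"
    proof -
      have "h2 ** h2 = mat 1"
        using e' by (simp only: h2_def matrix_distribs matrix_mul_lid matrix_mul_rid) simp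
      then show ?thesis by (simp add: k_def matrix_mul_assoc[symmetric])
    qed
    ultimately show ?thesis by (metis connected_component_trans)
  qed
  then show ?thesis
    by (meson connected_component_sym connected_component_trans connected_iff_connected_component)
qed

end


section \<open>From the Euclidean to the Zariski topology\<close>

lemma continuous_on_poly_fun: "poly_fun p \<Longrightarrow> continuous_on UNIV p"
  by (induction rule: poly_fun.induct) (auto intro!: continuous_intros)

lemma connectedin_zariski_if_connected:
  assumes "connected S"
  shows "connectedin zariski S"
proof -
  have "closed C" if C: "zariski_closed C" for C :: "(complex^'m^'m) set"
  proof -
    obtain P where P: "\<forall>p\<in>P. poly_fun p" "C = {A. \<forall>p\<in>P. p A = 0}"
      using C unfolding zariski_closed_def by auto
    have "closed {A. p A = 0}" if "p \<in> P" for p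
      using P(1) that by (intro closed_Collect_eq continuous_on_poly_fun continuous_intros) auto
    moreover have "C = (\<Inter>p\<in>P. {A. p A = 0})" using P(2) by auto
    ultimately show ?thesis by auto
  qed
  moreover have "topspace (zariski :: (complex^'m^'m) topology) = UNIV"
  proof -
    have "zariski_closed ({} :: (complex^'m^'m) set)"
      unfolding zariski_closed_def
      by (rule exI[of _ "{\<lambda>A. 1}"]) (auto intro: poly_fun.const)
    then show ?thesis using openin_subset[of zariski UNIV] by (auto simp: openin_zariski)
  qed
  ultimately have "continuous_map euclidean (zariski :: (complex^'m^'m) topology) id"
    by (auto simp: continuous_map_closedin closedin_zariski)
  from connectedin_continuous_map_image[OF this, of S] show ?thesis
    using assms by (simp add: connectedin_iff_connected)
qed


section \<open>Bivectors as self-adjoint operators\<close>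

lemma Jmat_adj: "Jmat ** adj g = transpose g ** Jmat"
proof -
  have "Jmat ** adj g = - ((Jmat ** Jmat) ** transpose g ** Jmat)"
    by (simp add: adj_def mat_mult_uminus matrix_mul_assoc)
  then show ?thesis by (simp add: Jmat_Jmat mat_mult_uminus)
qed

text \<open>Right multiplication by \<^const>\<open>Jmat\<close> turns bivectors into operators; for symplectic \<open>g\<close> the
  action on bivectors becomes conjugation, \<^term>\<open>adj g\<close> being the inverse of \<open>g\<close>.\<close>

lemma bivector_conjugation: "g ** A ** transpose g ** Jmat = g ** (A ** Jmat) ** adj g"
  by (simp add: matrix_mul_assoc[symmetric] Jmat_adj)

lemma times_Jmat_cancel: "A ** Jmat = B ** Jmat \<longleftrightarrow> A = B"
proof
  assume "A ** Jmat = B ** Jmat"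
  then have "A ** (Jmat ** Jmat) = B ** (Jmat ** Jmat)" by (simp add: matrix_mul_assoc)
  then show "A = B" by (simp add: Jmat_Jmat mat_mult_uminus)
qed simp

lemma bivector_conjugation_eq_iff:
  assumes "g \<in> Sp"
  shows "g ** A ** transpose g = B \<longleftrightarrow> g ** (A ** Jmat) = (B ** Jmat) ** g"
proof -
  have g: "adj g ** g = mat 1" "g ** adj g = mat 1"
    using assms Sp_iff_adj matrix_left_right_inverse by auto
  have "g ** A ** transpose g = B \<longleftrightarrow> g ** (A ** Jmat) ** adj g = B ** Jmat"
    unfolding bivector_conjugation[symmetric] times_Jmat_cancel ..
  also have "\<dots> \<longleftrightarrow> g ** (A ** Jmat) = (B ** Jmat) ** g"
  proof
    assume "g ** (A ** Jmat) ** adj g = B ** Jmat"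
    then have "B ** Jmat ** g = g ** (A ** Jmat) ** (adj g ** g)"
      by (simp add: matrix_mul_assoc)
    then show "g ** (A ** Jmat) = B ** Jmat ** g" by (simp add: g)
  next
    assume "g ** (A ** Jmat) = B ** Jmat ** g"
    then have "g ** (A ** Jmat) ** adj g = B ** Jmat ** (g ** adj g)"
      by (simp add: matrix_mul_assoc)
    then show "g ** (A ** Jmat) ** adj g = B ** Jmat" by (simp add: g)
  qed
  finally show ?thesis .
qed

lemma adj_bivector:
  assumes "transpose A = - A"
  shows "adj (A ** Jmat) = A ** Jmat"
proof -
  have "adj (A ** Jmat) = - ((Jmat ** Jmat) ** A ** Jmat)"
    by (simp add: adj_def matrix_transpose_mul assms transpose_Jmat mat_mult_uminus matrix_mul_assoc)
  then show ?thesis by (simp add: Jmat_Jmat mat_mult_uminus)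
qed

lemma abs_V2_eq_iff:
  assumes "transpose A = - A" "transpose B = - B"
  shows "abs_V2 A = abs_V2 B \<longleftrightarrow> (\<exists>c. A - B = mat c ** Jmat)"
  using Quotient_V2 assms V2_rel_refl
  by (metis (no_types, lifting) Quotient_rel V2_rel_def)

lemma V2_act_abs:
  assumes "g \<in> Sp" "transpose A = - A"
  shows "V2_act g (abs_V2 A) = abs_V2 (g ** A ** transpose g)"
  using V2_act.abs_eq[of A g] assms by (simp add: V2_rel_refl)

lemma transpose_conjugation:
  fixes A :: "complex^'k^'k"
  assumes "transpose A = - A"
  shows "transpose (g ** A ** transpose g) = - (g ** A ** transpose g)"
  by (simp add: matrix_transpose_mul assms mat_mult_uminus matrix_mul_assoc)

text \<open>An equality in the quotient lifts to bivectors: conjugation preserves the trace of the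
  operator, and \<^const>\<open>Jmat\<close> corresponds to a scalar operator of nonzero trace.\<close>

lemma V2_act_fixed_iff:
  fixes A :: "'n::finite cmat"
  assumes "g \<in> Sp" "transpose A = - A"
  shows "V2_act g (abs_V2 A) = abs_V2 A \<longleftrightarrow> g ** A ** transpose g = A"
proof
  have g: "adj g ** g = mat 1" using assms(1) by (simp add: Sp_iff_adj)
  assume "V2_act g (abs_V2 A) = abs_V2 A"
  then obtain c where c: "g ** A ** transpose g - A = mat c ** Jmat"
    using assms by (auto simp: V2_act_abs abs_V2_eq_iff transpose_conjugation)
  have "trace (g ** (A ** Jmat) ** adj g) = trace (adj g ** (g ** (A ** Jmat)))"
    by (rule trace_mul_sym)
  also have "\<dots> = trace (A ** Jmat)" by (simp add: matrix_mul_assoc g)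
  finally have "trace ((g ** A ** transpose g - A) ** Jmat) = 0"
    by (simp add: matrix_diff_rdistrib bivector_conjugation trace_sub)
  moreover have "mat c ** Jmat ** Jmat = - (mat c :: 'n cmat)"
    by (simp add: matrix_mul_assoc[symmetric] Jmat_Jmat mat_mult_uminus)
  ultimately have "trace (- (mat c :: 'n cmat)) = 0" by (simp add: c)
  then have "c = 0" by (simp add: trace_def mat_def)
  then show "g ** A ** transpose g = A" using c by (simp del: mat_0 add: mat_times_0)
qed (use assms in \<open>simp add: V2_act_abs\<close>)

text \<open>An eigenvector equation in the quotient holds up to a multiple \<open>c\<close> of \<^const>\<open>Jmat\<close>, which is
  itself fixed by \<open>s\<close>. As \<open>q \<noteq> 1\<close>, adding \<open>c / (q - 1)\<close> times \<^const>\<open>Jmat\<close> to the representative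
  removes the error.\<close>

lemma V2_eigenvector_representative:
  assumes s: "s \<in> Sp" and "q \<noteq> 1" and eig: "V2_act s X = V2_scale q X"
  obtains A where "transpose A = - A" "X = abs_V2 A" "s ** A ** transpose s = mat q ** A"
proof -
  obtain A0 where A0: "transpose A0 = - A0" "X = abs_V2 A0"
    by (metis Quotient_abs_rep Quotient_V2 Quotient_rep_reflp V2_rel_def)
  have "V2_scale q X = abs_V2 (mat q ** A0)"
    using V2_scale.abs_eq[of A0 q] A0 by (simp add: V2_rel_refl)
  then have "abs_V2 (s ** A0 ** transpose s) = abs_V2 (mat q ** A0)"
    using eig A0 s by (simp add: V2_act_abs)
  then obtain c where c: "s ** A0 ** transpose s - mat q ** A0 = mat c ** Jmat"
    using A0 by (auto simp: abs_V2_eq_iff transpose_conjugation transpose_mat_times mat_mult_uminus)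
  define d where "d = c / (q - 1)"
  define A where "A = A0 + mat d ** Jmat"
  have "transpose A = - A"
    by (simp add: A_def transpose_add A0 transpose_mat_times transpose_Jmat mat_mult_uminus)
  moreover have "X = abs_V2 A"
    unfolding A0(2) using A0(1) \<open>transpose A = - A\<close>
    by (subst abs_V2_eq_iff) (auto simp: A_def mat_times_uminus[symmetric])
  moreover have "s ** A ** transpose s = mat q ** A"
  proof -
    have "s ** A ** transpose s = s ** A0 ** transpose s + mat d ** (s ** Jmat ** transpose s)"
      by (simp add: A_def matrix_distribs mult_mat_times matrix_mul_assoc[symmetric])
    also have "\<dots> = mat q ** A0 + (mat c ** Jmat + mat d ** Jmat)"
      using c by (simp add: Sp_transpose[OF s] algebra_simps)
    also have "mat c ** Jmat + mat d ** Jmat = mat (q * d) ** (Jmat :: 'a cmat)"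
      unfolding mat_times_add[symmetric] using \<open>q \<noteq> 1\<close> by (simp add: d_def field_simps)
    finally show ?thesis by (simp add: A_def matrix_distribs mat_times_mat)
  qed
  ultimately show ?thesis using that by blast
qed

theorem theorem4p10:
  fixes B T :: "'n::finite cmat set"
    and s :: "'n cmat"
    and q :: "complex \<times> complex \<times> complex"
    and X :: "'n V"
  assumes "borel_subgroup B"
    and "maximal_torus T"
    and "T \<subseteq> B"
    and "pre_admissible_parameter B T s q X"
  shows "connectedin zariski (stabilizer (Sp_centralizer s) X)"
proof -
  obtain q0 q1 q2 where q: "q = (q0, q1, q2)" by (cases q)
  have s: "s \<in> Sp" "semisimple s" and q2: "\<And>k. 1 \<le> k \<Longrightarrow> k \<le> 2 * CARD('n) \<Longrightarrow> q2 ^ k \<noteq> 1"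
    and eig: "V2_act s (snd X) = V2_scale q2 (snd X)"
    using assms(4) by (auto simp: q pre_admissible_parameter_def pre_admissible_def)
  have "q2 \<noteq> 1" using q2[of 1] by (simp add: Suc_le_eq)
  then obtain A where A: "transpose A = - A" "snd X = abs_V2 A" "s ** A ** transpose s = mat q2 ** A"
    using V2_eigenvector_representative[OF s(1) _ eig] by blast
  define x where "x = A ** Jmat"
  have "s ** x = mat q2 ** (x ** s)"
    using A(3) s(1) by (simp add: bivector_conjugation_eq_iff x_def matrix_mul_assoc)
  then interpret exotic_pair s x q2
    using s q2 by unfold_locales (auto simp: x_def adj_bivector A(1) Sp_iff_adj)
  have "stabilizer (Sp_centralizer s) X = sympl_stab s x (fst X)"
    by (auto simp: stabilizer_def Sp_centralizer_def sympl_stab_def V_act_def prod_eq_iff A(2)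
        V2_act_fixed_iff A(1) bivector_conjugation_eq_iff x_def Sp_iff_adj)
  then show ?thesis
    using connectedin_zariski_if_connected[OF connected_sympl_stab, of "fst X"] by simp
qed

end
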